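(* Let $K \neq \mathbb{Q}(\sqrt{-3})$ be an imaginary quadratic field with ring of integers $\mathcal{O}_K$. Whenever $\mathcal{O}_K$ is non-Euclidean, the subgroup $E_2(\mathcal{O}_K)$ of $\mathrm{PSL}_2(\mathcal{O}_K)$ generated by elementary matrices is a thin group.
   Context: $K$ is an imaginary quadratic field of discriminant $\Delta<0$, $\Delta \neq -3$, with ring of integers $\mathcal{O}_K$ having integral basis $1,\tau$, where $\tau^2=\Delta/4$ if $\Delta\equiv 0 \pmod 4$ and $\tau^2=\tau+(\Delta-1)/4$ if $\Delta \equiv 1 \pmod 4$. The group $E_2(\mathcal{O}_K)$ is generated by $\mathrm{PSL}_2(\mathbb{Z})$ together with the matrix $\begin{pmatrix}1&\tau\\0&1\end{pmatrix}$. The group of Möbius transformations of $\widehat{\mathbb{C}}$ (including reflections) is identified with the orthochronous Lorentz group $\mathrm{O}^+_{3,1}(\mathbb{R})$ of a real quadratic form $M$ of signature $(3,1)$ (via the action on Hermitian $2\times 2$ matrices), so subgroups of $\mathrm{PSL}_2(\mathcal{O}_K)$ are regarded as subgroups of $\mathrm{O}_M(\mathbb{Z})$. A subgroup $X$ of $H(\mathbb{Z})$, for a semisimple group $H$, is called thin if it is of infinite index in $G(\mathbb{Z})$, where $G$ is the Zariski closure of $X$ in $H$. *)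

theory Defs
  imports "HOL-Analysis.Analysis" "HOL-Algebra.Algebra" "HOL-Algebra.Algebraic_Closure_Type"
begin

subsection \<open>Imaginary quadratic fields\<close>

text \<open>Number fields are taken as subfields of the complex numbers, where the matrix groups below
  act by Moebius transformations.\<close>

abbreviation complex_ring :: "complex ring" where
  "complex_ring \<equiv> ring_of_type_algebra"

definition imag_quadratic_field :: "complex set \<Rightarrow> bool" where
  "imag_quadratic_field K \<longleftrightarrow>
     subfield K complex_ring \<and> ring.dimension complex_ring 2 \<rat> K \<and> \<not> K \<subseteq> \<real>"

definition ring_of_integers :: "complex set \<Rightarrow> complex set" where
  "ring_of_integers K = {x \<in> K. algebraic_int x}"

definition euclidean_integers :: "complex set \<Rightarrow> bool" where
  "euclidean_integers K \<longleftrightarrow>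
     (\<exists>\<phi>. euclidean_domain (complex_ring\<lparr>carrier := ring_of_integers K\<rparr>) \<phi>)"

definition integral_basis :: "complex set \<Rightarrow> complex \<Rightarrow> complex \<Rightarrow> bool" where
  "integral_basis K \<omega>\<^sub>1 \<omega>\<^sub>2 \<longleftrightarrow>
     bij_betw (\<lambda>(a :: int, b :: int). of_int a * \<omega>\<^sub>1 + of_int b * \<omega>\<^sub>2) UNIV (ring_of_integers K)"

text \<open>The square of the determinant formed from the two embeddings of an integral basis.  The
  second embedding of an imaginary quadratic field is complex conjugation; the description is
  meant for such fields only.\<close>

definition field_disc :: "complex set \<Rightarrow> int" where
  "field_disc K = (THE D. \<exists>\<omega>\<^sub>1 \<omega>\<^sub>2. integral_basis K \<omega>\<^sub>1 \<omega>\<^sub>2 \<and>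
     of_int D = (\<omega>\<^sub>1 * cnj \<omega>\<^sub>2 - \<omega>\<^sub>2 * cnj \<omega>\<^sub>1)\<^sup>2)"


subsection \<open>The group generated by elementary matrices\<close>

definition mat_group :: "('a :: semiring_1 ^ 'n ^ 'n) set \<Rightarrow> ('a ^ 'n ^ 'n) monoid" where
  "mat_group S = \<lparr>carrier = S, mult = (**), one = mat 1\<rparr>"

definition SL2 :: "complex set \<Rightarrow> (complex ^ 2 ^ 2) monoid" where
  "SL2 R = mat_group {A. (\<forall>i j. A $ i $ j \<in> R) \<and> det A = 1}"

abbreviation pm_one :: "(complex ^ 2 ^ 2) set" where
  "pm_one \<equiv> {mat 1, - mat 1}"

definition PSL2 :: "complex set \<Rightarrow> (complex ^ 2 ^ 2) set monoid" where
  "PSL2 R = SL2 R Mod pm_one"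

definition elementary_matrices :: "complex set \<Rightarrow> (complex ^ 2 ^ 2) set" where
  "elementary_matrices R =
     (\<Union>x\<in>R. {vector [vector [1, x], vector [0, 1]], vector [vector [1, 0], vector [x, 1]]})"

definition E2 :: "complex set \<Rightarrow> (complex ^ 2 ^ 2) set set" where
  "E2 R = generate (PSL2 R) ((\<lambda>A. pm_one #>\<^bsub>SL2 R\<^esub> A) ` elementary_matrices R)"


subsection \<open>The action on Hermitian matrices\<close>

text \<open>The coordinates \<open>(a, d, b, c)\<close> stand for the Hermitian matrix with diagonal \<open>a, d\<close> and upper
  right entry \<open>b + c \<tau>\<close>.  If \<open>1, \<tau>\<close> is an integral basis, then integral vectors correspond to the
  Hermitian matrices with integral entries, a lattice preserved by \<open>SL\<^sub>2\<close> of the ring of integers.\<close>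

definition herm :: "complex \<Rightarrow> real ^ 4 \<Rightarrow> complex ^ 2 ^ 2" where
  "herm \<tau> v = (let \<beta> = of_real (v $ 3) + of_real (v $ 4) * \<tau> in
     vector [vector [of_real (v $ 1), \<beta>], vector [cnj \<beta>, of_real (v $ 2)]])"

text \<open>The sign is chosen so that the signature is \<open>(3,1)\<close> (for non-real \<open>\<tau>\<close>).\<close>

definition herm_form :: "complex \<Rightarrow> real ^ 4 \<Rightarrow> real" where
  "herm_form \<tau> v = - Re (det (herm \<tau> v))"

definition conj_transpose :: "complex ^ 'n ^ 'm \<Rightarrow> complex ^ 'm ^ 'n" where
  "conj_transpose A = (\<chi> i j. cnj (A $ j $ i))"

definition herm_action :: "complex \<Rightarrow> complex ^ 2 ^ 2 \<Rightarrow> real ^ 4 ^ 4" where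
  "herm_action \<tau> g = matrix (\<lambda>v. inv_into UNIV (herm \<tau>) (g ** herm \<tau> v ** conj_transpose g))"

text \<open>The action of a class modulo sign: \<open>g\<close> and \<open>- g\<close> act alike, so the image below is a
  singleton.\<close>

definition psl_action :: "complex \<Rightarrow> (complex ^ 2 ^ 2) set \<Rightarrow> real ^ 4 ^ 4" where
  "psl_action \<tau> S = the_elem (herm_action \<tau> ` S)"


subsection \<open>Thin groups\<close>

definition orth_group :: "(real ^ 'n \<Rightarrow> real) \<Rightarrow> (real ^ 'n ^ 'n) set" where
  "orth_group q = {A. invertible A \<and> (\<forall>v. q (A *v v) = q v)}"

definition integer_points :: "(real ^ 'n ^ 'n) set \<Rightarrow> (real ^ 'n ^ 'n) set" where
  "integer_points H = {A \<in> H. \<forall>i j. A $ i $ j \<in> \<int>}"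

definition zariski_closure :: "(real ^ 'n ^ 'n) set \<Rightarrow> (real ^ 'n ^ 'n) set \<Rightarrow> (real ^ 'n ^ 'n) set" where
  "zariski_closure H \<Gamma> =
     {A \<in> H. \<forall>p. real_polynomial_function p \<and> (\<forall>B\<in>\<Gamma>. p B = 0) \<longrightarrow> p A = 0}"

text \<open>Meant for groups \<open>H\<close> of matrices of determinant \<open>1\<close> or \<open>-1\<close>, such as orthogonal groups of
  nondegenerate forms.  There integral matrices have integral inverses, and every regular function
  on \<open>H\<close> is the restriction of a polynomial in the matrix entries.\<close>

definition thin_subgroup :: "(real ^ 'n ^ 'n) set \<Rightarrow> (real ^ 'n ^ 'n) set \<Rightarrow> bool" where
  "thin_subgroup H \<Gamma> \<longleftrightarrow>
     subgroup \<Gamma> (mat_group (integer_points H)) \<and>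
     infinite (rcosets\<^bsub>mat_group (integer_points (zariski_closure H \<Gamma>))\<^esub> \<Gamma>)"

end

theory Submission
  imports Defs
begin

text \<open>Write \<open>R\<close> for the ring of integers. The image of \<open>E\<^sub>2(R)\<close> in the orthogonal group is Zariski dense
  in the image of \<open>SL\<^sub>2\<close> of the complex numbers: along each one-parameter group of elementary matrices
  the action is polynomial in the parameter, so a polynomial vanishing at the integer parameters
  vanishes identically, and a matrix with nonzero lower left entry is a product of three elementary ones.
  Hence it suffices that \<open>E\<^sub>2(R)\<close> has infinite index in \<open>SL\<^sub>2(R)\<close>.

  If \<open>R\<close> is not Euclidean, its discriminant is at most \<open>- 15\<close>, so every element of \<open>R\<close> other than
  \<open>0, 1, - 1\<close> has absolute value at least 2, and there are points at distance more than 1 from all of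
  \<open>R\<close>. Writing elements of \<open>E\<^sub>2(R)\<close> as words in the inversion \<open>S\<close> and the translations \<open>T\<^sup>q\<close>, with
  inner exponents of absolute value at least 2, a ping-pong argument shows that such a word maps a point
  far from \<open>R\<close> either to a translate or into an open unit disc around an element of \<open>R\<close>. So the points
  of a small square far from \<open>R\<close> are pairwise inequivalent under \<open>E\<^sub>2(R)\<close>, whereas this square
  contains infinitely many points of the \<open>SL\<^sub>2(R)\<close>-orbit of infinity, namely \<open>(1 + 2 r) / 2\<^sup>k\<close>.\<close>

no_notation fps_nth (infixl "$" 75)

subsection \<open>Ping-pong for discretely normed rings\<close>

text \<open>With S the map sending u to - 1 / u and q = 1 or q = - 1, this relation trades two
  inversions for one. It holds because (q - 1 / u) (q + 1 / (u - q)) collapses to q q = 1.\<close>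

lemma inverse_conjugate_sign:
  fixes q u :: "'a::field"
  assumes "q * q = 1" "u \<noteq> 0" "u - q \<noteq> 0"
  shows "- inverse (q - inverse u) = - q + - inverse (u - q)"
proof -
  have "(q - inverse u) * (q + inverse (u - q)) =
      q * q + (q * u - q * (u - q) - 1) / (u * (u - q))"
    using assms(2,3) by (simp add: divide_simps) (simp add: algebra_simps)
  also have "q * u - q * (u - q) - 1 = 0"
    using assms(1) by (simp add: algebra_simps)
  finally have "(q - inverse u) * (q + inverse (u - q)) = 1"
    using assms(1) by simp
  then have "inverse (q - inverse u) = q + inverse (u - q)"
    by (rule inverse_unique)
  then show ?thesis by simp
qed

locale complex_subring =
  fixes R :: "complex set"
  assumes zero_closed [simp]: "0 \<in> R" and one_closed [simp]: "1 \<in> R"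
    and add_closed [simp]: "x \<in> R \<Longrightarrow> y \<in> R \<Longrightarrow> x + y \<in> R"
    and uminus_closed [simp]: "x \<in> R \<Longrightarrow> - x \<in> R"
    and mult_closed [simp]: "x \<in> R \<Longrightarrow> y \<in> R \<Longrightarrow> x * y \<in> R"
begin

lemma diff_closed [simp]: "x \<in> R \<Longrightarrow> y \<in> R \<Longrightarrow> x - y \<in> R"
  using add_closed[of x "- y"] by simp

end

text \<open>Cohn's condition in the case where the only units are 1 and - 1: a further unit and its
  inverse would both have norm at least 2.\<close>

locale discretely_normed_ring = complex_subring +
  assumes norm_ge_2: "x \<in> R \<Longrightarrow> x \<notin> {0, 1, - 1} \<Longrightarrow> 2 \<le> norm x"
begin

text \<open>Values at z of words alternating translations and inversions in which every exponent has
  norm at least 2, except the one applied first. That one is free because z will be far from all of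
  R.\<close>

inductive_set expanding_tails :: "complex \<Rightarrow> complex set" for z where
  base: "q \<in> R \<Longrightarrow> z + q \<in> expanding_tails z"
| step: "w \<in> expanding_tails z \<Longrightarrow> q \<in> R \<Longrightarrow> 2 \<le> norm q \<Longrightarrow> q - inverse w \<in> expanding_tails z"

text \<open>Here the translation applied last is free as well. For z far from R the set is stable
  under translations by R and under the inversion, so it contains the whole orbit of z.\<close>

definition reduced_orbit :: "complex \<Rightarrow> complex set" where
  "reduced_orbit z = {z + q |q. q \<in> R} \<union> {q - inverse w |q w. q \<in> R \<and> w \<in> expanding_tails z}"

definition far_from_ring :: "complex \<Rightarrow> bool" where
  "far_from_ring z \<longleftrightarrow> (\<forall>q\<in>R. 1 < norm (z - q))"

text \<open>The ping-pong estimate: inversion sends the outside of the unit disc into its interior,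
  and a translation of length at least 2 sends that interior outside again.\<close>

lemma norm_expanding_tails:
  assumes "far_from_ring z" "w \<in> expanding_tails z"
  shows "1 < norm w"
  using assms(2)
proof induction
  case (base q)
  then show ?case
    using assms(1) uminus_closed[OF base] unfolding far_from_ring_def by fastforce
next
  case (step w q)
  have "norm (inverse w) < 1"
    using step.IH by (simp add: norm_inverse inverse_less_1_iff)
  moreover have "norm q \<le> norm (q - inverse w) + norm (inverse w)"
    using norm_triangle_sub[of q "inverse w"] by (simp add: add.commute)
  ultimately show ?case
    using step.hyps by linarith
qed

lemma expanding_tails_subset: "expanding_tails z \<subseteq> reduced_orbit z"
proof
  fix w assume "w \<in> expanding_tails z"
  then show "w \<in> reduced_orbit z"
    unfolding reduced_orbit_def by (cases rule: expanding_tails.cases) blast+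
qed

lemma reduced_orbit_self: "z \<in> reduced_orbit z"
proof -
  have "z = z + 0" by simp
  then show ?thesis unfolding reduced_orbit_def using zero_closed by blast
qed

lemma reduced_orbit_add:
  assumes "w \<in> reduced_orbit z" "r \<in> R"
  shows "r + w \<in> reduced_orbit z"
proof -
  from assms(1) consider q where "w = z + q" "q \<in> R"
    | q v where "w = q - inverse v" "q \<in> R" "v \<in> expanding_tails z"
    unfolding reduced_orbit_def by blast
  then show ?thesis
  proof cases
    case 1
    then have "r + w = z + (r + q)" "r + q \<in> R" using assms(2) by auto
    then show ?thesis unfolding reduced_orbit_def by blast
  next
    case 2
    then have "r + w = (r + q) - inverse v" "r + q \<in> R" using assms(2) by auto
    then show ?thesis unfolding reduced_orbit_def using 2 by blast
  qed
qed

lemma inverse_expanding_tail: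
  assumes "w \<in> expanding_tails z"
  shows "- inverse w \<in> reduced_orbit z"
proof -
  have "- inverse w = 0 - inverse w" by simp
  then show ?thesis unfolding reduced_orbit_def using assms zero_closed by blast
qed

text \<open>No point of the orbit is sent to infinity by the inversion, so the convention
  \<open>inverse 0 = 0\<close> never interferes. In the second form of a point, either q = 0 and the
  point is - 1 / v, or the norm of q is at least 1 and exceeds that of 1 / v.\<close>

lemma reduced_orbit_nonzero:
  assumes "far_from_ring z" "w \<in> reduced_orbit z"
  shows "w \<noteq> 0"
proof -
  from assms(2) consider q where "w = z + q" "q \<in> R"
    | q v where "w = q - inverse v" "q \<in> R" "v \<in> expanding_tails z"
    unfolding reduced_orbit_def by blast
  then show ?thesis
  proof cases
    case 1
    then have "1 < norm w"
      using norm_expanding_tails[OF assms(1) expanding_tails.base] by blast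
    then show ?thesis by auto
  next
    case 2
    then have v: "1 < norm v"
      using norm_expanding_tails[OF assms(1)] by blast
    then have "v \<noteq> 0" "norm (inverse v) < 1"
      by (auto simp: norm_inverse inverse_less_1_iff)
    then show ?thesis
      using 2 norm_ge_2[of q] by (cases "q = 0") force+
  qed
qed

text \<open>The case \<open>q = \<plusminus>1\<close> is the relation \<open>S T\<^sup>\<plusminus>\<^sup>1 S = T\<^sup>\<mp>\<^sup>1 S T\<^sup>\<mp>\<^sup>1\<close>, which shortens the word.\<close>

lemma inverse_translated_tail:
  assumes z: "far_from_ring z" and "w \<in> expanding_tails z" "q \<in> R"
  shows "- inverse (q - inverse w) \<in> reduced_orbit z"
  using assms(2,3)
proof (induction arbitrary: q)
  case w: (base p q)
  let ?w = "z + p"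
  have w1: "?w \<in> expanding_tails z" using w(1) by (rule expanding_tails.base)
  have shift: "?w - e \<in> expanding_tails z" if "e \<in> R" for e
    using expanding_tails.base[of "p - e" z] w that by (simp add: add_diff_eq)
  consider "q = 0" | "q = 1 \<or> q = -1" | "2 \<le> norm q"
    using norm_ge_2 w by blast
  then show ?case
  proof cases
    case 1
    then have "- inverse (q - inverse ?w) = ?w" by (simp add: inverse_minus_eq)
    then show ?thesis using expanding_tails_subset w1 by force
  next
    case 2
    then have qq: "q * q = 1" by auto
    have nz: "?w \<noteq> 0" "?w - q \<noteq> 0"
      using norm_expanding_tails[OF z w1] norm_expanding_tails[OF z shift[OF \<open>q \<in> R\<close>]] by auto
    have "- inverse (q - inverse ?w) = - q + - inverse (?w - q)"
      using nz qq by (intro inverse_conjugate_sign)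
    then show ?thesis
      using reduced_orbit_add[OF inverse_expanding_tail[OF shift]] w by auto
  next
    case 3
    then show ?thesis
      by (intro inverse_expanding_tail expanding_tails.step w1 w)
  qed
next
  case v: (step v p q)
  let ?w = "p - inverse v"
  have w1: "?w \<in> expanding_tails z" using v.hyps by (intro expanding_tails.step)
  consider "q = 0" | "q = 1 \<or> q = -1" | "2 \<le> norm q"
    using norm_ge_2 v by blast
  then show ?case
  proof cases
    case 1
    then have "- inverse (q - inverse ?w) = ?w" by (simp add: inverse_minus_eq)
    then show ?thesis using expanding_tails_subset w1 by force
  next
    case 2
    then have qq: "q * q = 1" by auto
    \<comment> \<open>Now \<open>p - q\<close> may have norm below 2, so \<open>?w - q\<close> need
      not be an expanding tail. It still lies in the reduced orbit, and its inversion is covered by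
      the induction hypothesis for v with exponent \<open>p - q\<close>.\<close>
    have "?w - q = (p - q) - inverse v" by simp
    moreover have "(p - q) - inverse v \<in> reduced_orbit z"
      using v.hyps(1) diff_closed[OF v.hyps(2) v.prems] unfolding reduced_orbit_def by blast
    ultimately have "?w - q \<in> reduced_orbit z" by metis
    then have nz: "?w \<noteq> 0" "?w - q \<noteq> 0"
      using norm_expanding_tails[OF z w1] reduced_orbit_nonzero[OF z, of "?w - q"] by fastforce+
    have "- inverse (q - inverse ?w) = - q + - inverse (?w - q)"
      using nz qq by (intro inverse_conjugate_sign)
    also have "?w - q = (p - q) - inverse v" by simp
    finally have "- inverse (q - inverse ?w) = - q + - inverse ((p - q) - inverse v)" .
    then show ?thesis
      using reduced_orbit_add[OF v.IH[of "p - q"]] v by auto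
  next
    case 3
    then show ?thesis
      by (intro inverse_expanding_tail expanding_tails.step w1 v)
  qed
qed

lemma reduced_orbit_inverse:
  assumes "far_from_ring z" "w \<in> reduced_orbit z"
  shows "- inverse w \<in> reduced_orbit z"
  using assms(2) inverse_translated_tail[OF assms(1)]
    inverse_expanding_tail[OF expanding_tails.base]
  unfolding reduced_orbit_def by blast

text \<open>Points of the second form lie within distance 1 of some q in R, so only translates of z
  can be far from R. This is what separates orbits.\<close>

lemma reduced_orbit_far:
  assumes "far_from_ring z" "w \<in> reduced_orbit z" "far_from_ring w"
  shows "w - z \<in> R"
proof -
  from assms(2) consider q where "w = z + q" "q \<in> R"
    | q v where "w = q - inverse v" "q \<in> R" "v \<in> expanding_tails z"
    unfolding reduced_orbit_def by blast
  then show ?thesis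
  proof cases
    case 1
    then show ?thesis by simp
  next
    case 2
    then have "1 < norm v"
      using norm_expanding_tails[OF assms(1)] by blast
    then have "norm (w - q) < 1"
      using 2 by (auto simp: norm_inverse inverse_less_1_iff)
    then show ?thesis
      using assms(3) 2 unfolding far_from_ring_def by force
  qed
qed

end

subsection \<open>The action on Hermitian matrices\<close>

text \<open>An explicit inverse of \<open>herm\<close> on Hermitian matrices: solving \<beta> = b +
  c \<tau> for real b and c gives c = Im \<beta> / Im \<tau>. It is linear on all matrices, which
  the choice of preimages in \<open>inv_into\<close> does not give.\<close>

definition unherm :: "complex \<Rightarrow> complex ^ 2 ^ 2 \<Rightarrow> real ^ 4" where
  "unherm \<tau> H = vector [Re (H $ 1 $ 1), Re (H $ 2 $ 2),
     Re (H $ 1 $ 2) - Im (H $ 1 $ 2) / Im \<tau> * Re \<tau>, Im (H $ 1 $ 2) / Im \<tau>]"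

lemma vector_4_nth [simp]:
  fixes a b c d :: "'a::zero"
  defines "v \<equiv> vector [a, b, c, d] :: 'a ^ 4"
  shows "v $ 1 = a" "v $ 2 = b" "v $ 3 = c" "v $ 4 = d"
  unfolding v_def vector_def by simp_all

lemma mat2_eqI:
  fixes A B :: "'a ^ 2 ^ 2"
  assumes "A $ 1 $ 1 = B $ 1 $ 1" "A $ 1 $ 2 = B $ 1 $ 2" "A $ 2 $ 1 = B $ 2 $ 1" "A $ 2 $ 2 = B $ 2 $ 2"
  shows "A = B"
  using assms by (simp add: vec_eq_iff forall_2)

lemma conj_transpose_nth [simp]: "conj_transpose A $ i $ j = cnj (A $ j $ i)"
  by (simp add: conj_transpose_def)

lemma conj_transpose_conj_transpose [simp]: "conj_transpose (conj_transpose A) = A"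
  by (simp add: vec_eq_iff)

lemma conj_transpose_mult: "conj_transpose (A ** B) = conj_transpose B ** conj_transpose A"
  by (simp add: vec_eq_iff matrix_matrix_mult_def mult.commute)

lemma conj_transpose_mat_1 [simp]: "conj_transpose (mat 1) = mat 1"
  by (simp add: vec_eq_iff mat_def)

lemma det_conj_transpose_2: "det (conj_transpose A) = cnj (det A)" for A :: "complex ^ 2 ^ 2"
  by (simp add: det_2 mult.commute)

lemma herm_nth [simp]:
  "herm \<tau> v $ 1 $ 1 = of_real (v $ 1)" "herm \<tau> v $ 2 $ 2 = of_real (v $ 2)"
  "herm \<tau> v $ 1 $ 2 = of_real (v $ 3) + of_real (v $ 4) * \<tau>"
  "herm \<tau> v $ 2 $ 1 = of_real (v $ 3) + of_real (v $ 4) * cnj \<tau>"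
  by (simp_all add: herm_def Let_def)

lemma unherm_herm [simp]: "Im \<tau> \<noteq> 0 \<Longrightarrow> unherm \<tau> (herm \<tau> v) = v"
  by (simp add: unherm_def vec_eq_iff forall_4)

lemma herm_unherm:
  assumes "Im \<tau> \<noteq> 0" "conj_transpose H = H"
  shows "herm \<tau> (unherm \<tau> H) = H"
proof -
  have H: "cnj (H $ j $ i) = H $ i $ j" for i j
    using assms(2) by (metis conj_transpose_nth)
  have "Im (H $ 1 $ 1) = 0" "Im (H $ 2 $ 2) = 0" 
    using H[of 1 1] H[of 2 2] by (auto simp: complex_eq_iff)
  moreover have "herm \<tau> v $ 2 $ 1 = cnj (herm \<tau> v $ 1 $ 2)" for v by simp
  moreover have "herm \<tau> (unherm \<tau> H) $ 1 $ 2 = H $ 1 $ 2"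
    using assms(1) by (simp add: unherm_def complex_eq_iff)
  ultimately show ?thesis
    using H[of 2 1] by (intro mat2_eqI) (simp_all add: unherm_def complex_eq_iff del: herm_nth(3,4))
qed

lemma conj_transpose_herm [simp]: "conj_transpose (herm \<tau> v) = herm \<tau> v"
  by (rule mat2_eqI) simp_all

lemma inv_herm:
  assumes "Im \<tau> \<noteq> 0" "conj_transpose H = H"
  shows "inv_into UNIV (herm \<tau>) H = unherm \<tau> H"
proof (rule inv_into_f_eq)
  show "inj (herm \<tau>)"
    using unherm_herm[OF assms(1)] by (metis injI)
qed (use assms herm_unherm in auto)

lemma linear_herm: "linear (herm \<tau>)"
  by (rule linearI; rule mat2_eqI) (simp_all add: algebra_simps scaleR_conv_of_real[where 'a=complex])

lemma linear_unherm: "linear (unherm \<tau>)"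
  by (rule linearI) (auto simp: unherm_def vec_eq_iff forall_4 field_simps add_divide_distrib)

lemma matrix_mult_2 [simp]:
  fixes A B :: "'a::semiring_1 ^ 2 ^ 2"
  shows "(A ** B) $ i $ j = A $ i $ 1 * B $ 1 $ j + A $ i $ 2 * B $ 2 $ j"
  by (simp add: matrix_matrix_mult_def sum_2)

lemma linear_sandwich: "linear (\<lambda>Y. (A :: complex ^ 2 ^ 2) ** Y ** (B :: complex ^ 2 ^ 2))"
  by (rule linearI; rule mat2_eqI) (simp_all add: algebra_simps)

text \<open>Stated for arbitrary maps of matrices, so that it also covers Y to N Y + Y N', with N'
  the conjugate transpose; this is the linear coefficient along a one-parameter family.\<close>

definition herm_map :: "complex \<Rightarrow> (complex ^ 2 ^ 2 \<Rightarrow> complex ^ 2 ^ 2) \<Rightarrow> real ^ 4 ^ 4" where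
  "herm_map \<tau> f = matrix (\<lambda>v. unherm \<tau> (f (herm \<tau> v)))"

lemma herm_map_mult:
  assumes "linear f"
  shows "herm_map \<tau> f *v v = unherm \<tau> (f (herm \<tau> v))"
proof -
  have "linear (unherm \<tau> \<circ> (f \<circ> herm \<tau>))"
    using assms by (intro linear_compose linear_herm linear_unherm)
  then have "linear (\<lambda>v. unherm \<tau> (f (herm \<tau> v)))"
    by (simp add: o_def)
  from matrix_vector_mul(2)[OF this] show ?thesis
    unfolding herm_map_def by metis
qed

lemma herm_action_eq:
  assumes "Im \<tau> \<noteq> 0"
  shows "herm_action \<tau> g = herm_map \<tau> (\<lambda>Y. g ** Y ** conj_transpose g)"
  unfolding herm_action_def herm_map_def
  by (simp add: inv_herm[OF assms] conj_transpose_mult matrix_mul_assoc)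

lemma herm_action_mult_vec:
  assumes "Im \<tau> \<noteq> 0"
  shows "herm_action \<tau> g *v v = unherm \<tau> (g ** herm \<tau> v ** conj_transpose g)"
  unfolding herm_action_eq[OF assms] by (intro herm_map_mult linear_sandwich)

lemma herm_herm_action:
  assumes "Im \<tau> \<noteq> 0"
  shows "herm \<tau> (herm_action \<tau> g *v v) = g ** herm \<tau> v ** conj_transpose g"
  unfolding herm_action_mult_vec[OF assms]
  by (intro herm_unherm assms) (simp add: conj_transpose_mult matrix_mul_assoc)

lemma herm_action_mult:
  assumes "Im \<tau> \<noteq> 0"
  shows "herm_action \<tau> (g ** h) = herm_action \<tau> g ** herm_action \<tau> h"
  unfolding matrix_eq
proof
  fix v
  have "herm \<tau> (herm_action \<tau> (g ** h) *v v) = herm \<tau> (herm_action \<tau> g *v (herm_action \<tau> h *v v))"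
    by (simp add: herm_herm_action[OF assms] conj_transpose_mult matrix_mul_assoc)
  then show "herm_action \<tau> (g ** h) *v v = herm_action \<tau> g ** herm_action \<tau> h *v v"
    by (metis unherm_herm[OF assms] matrix_vector_mul_assoc)
qed

lemma herm_action_one:
  assumes "Im \<tau> \<noteq> 0"
  shows "herm_action \<tau> (mat 1) = mat 1"
  by (simp add: matrix_eq herm_action_mult_vec[OF assms] assms)

lemma herm_action_uminus: "herm_action \<tau> (- g) = herm_action \<tau> g"
proof -
  have "- g ** Y ** conj_transpose (- g) = g ** Y ** conj_transpose g" for Y
    by (rule mat2_eqI) (simp_all add: algebra_simps)
  then show ?thesis by (simp add: herm_action_def)
qed

text \<open>The determinant of the transformed Hermitian matrix is multiplied by the squared
  absolute value of \<open>det g\<close>.\<close>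

lemma herm_form_herm_action:
  assumes "Im \<tau> \<noteq> 0" "det g = 1"
  shows "herm_form \<tau> (herm_action \<tau> g *v v) = herm_form \<tau> v"
  by (simp add: herm_form_def herm_herm_action[OF assms(1)] det_mul det_conj_transpose_2 assms(2))

text \<open>The adjugate, which is the inverse in determinant 1. Free of division, it visibly keeps
  the entries in a subring.\<close>

definition mat2_inv :: "'a::comm_ring_1 ^ 2 ^ 2 \<Rightarrow> 'a ^ 2 ^ 2" where
  "mat2_inv A = vector [vector [A $ 2 $ 2, - A $ 1 $ 2], vector [- A $ 2 $ 1, A $ 1 $ 1]]"

lemma mat2_inv:
  assumes "det A = 1"
  shows "A ** mat2_inv A = mat 1" "mat2_inv A ** A = mat 1"
  using assms
  by (auto intro!: mat2_eqI simp: mat2_inv_def mat_def det_2 algebra_simps)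

lemma det_mat2_inv: "det (mat2_inv A) = det A"
  by (simp add: mat2_inv_def det_2 mult.commute)

lemma herm_action_in_orth_group:
  assumes "Im \<tau> \<noteq> 0" "det g = 1"
  shows "herm_action \<tau> g \<in> orth_group (herm_form \<tau>)"
proof -
  have "invertible (herm_action \<tau> g)"
    unfolding invertible_def using mat2_inv[OF assms(2)] assms(1)
    by (metis herm_action_mult herm_action_one)
  then show ?thesis
    by (simp add: orth_group_def herm_form_herm_action assms)
qed

subsection \<open>The elementary group\<close>

definition upper_elem :: "complex \<Rightarrow> complex ^ 2 ^ 2" where
  "upper_elem x = vector [vector [1, x], vector [0, 1]]"

definition lower_elem :: "complex \<Rightarrow> complex ^ 2 ^ 2" where
  "lower_elem x = vector [vector [1, 0], vector [x, 1]]"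

lemma upper_elem_nth [simp]:
  "upper_elem x $ 1 $ 1 = 1" "upper_elem x $ 1 $ 2 = x"
  "upper_elem x $ 2 $ 1 = 0" "upper_elem x $ 2 $ 2 = 1"
  by (simp_all add: upper_elem_def)

lemma lower_elem_nth [simp]:
  "lower_elem x $ 1 $ 1 = 1" "lower_elem x $ 1 $ 2 = 0"
  "lower_elem x $ 2 $ 1 = x" "lower_elem x $ 2 $ 2 = 1"
  by (simp_all add: lower_elem_def)

lemma mat_1_nth_2 [simp]:
  "(mat 1 :: complex ^ 2 ^ 2) $ 1 $ 1 = 1" "(mat 1 :: complex ^ 2 ^ 2) $ 1 $ 2 = 0"
  "(mat 1 :: complex ^ 2 ^ 2) $ 2 $ 1 = 0" "(mat 1 :: complex ^ 2 ^ 2) $ 2 $ 2 = 1"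
  by (simp_all add: mat_def)

lemma det_upper_elem [simp]: "det (upper_elem x) = 1"
  and det_lower_elem [simp]: "det (lower_elem x) = 1"
  by (simp_all add: det_2)

lemma mat2_inv_upper_elem [simp]: "mat2_inv (upper_elem x) = upper_elem (- x)"
  and mat2_inv_lower_elem [simp]: "mat2_inv (lower_elem x) = lower_elem (- x)"
  by (auto intro!: mat2_eqI simp: mat2_inv_def)

lemma mat2_inv_one [simp]: "mat2_inv (mat 1) = (mat 1 :: complex ^ 2 ^ 2)"
  by (auto intro!: mat2_eqI simp: mat2_inv_def)

lemma mat2_inv_mult: "mat2_inv (A ** B) = mat2_inv B ** mat2_inv A"
  by (auto intro!: mat2_eqI simp: mat2_inv_def algebra_simps)

lemma upper_elem_add: "upper_elem (x + y) = upper_elem x ** upper_elem y"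
  by (auto intro!: mat2_eqI)

lemma elementary_matrices_eq: "elementary_matrices R = upper_elem ` R \<union> lower_elem ` R"
  unfolding elementary_matrices_def upper_elem_def lower_elem_def by blast

lemma matrix_mult_uminus_left_2 [simp]: "(- A) ** B = - (A ** B)"
  and matrix_mult_uminus_right_2 [simp]: "A ** (- B) = - (A ** B)" for A B :: "complex ^ 2 ^ 2"
  by (auto intro!: mat2_eqI)

text \<open>Inverses are omitted, as the inverse of an elementary matrix is elementary when R is
  closed under negation. Building words by left multiplication lets inductions follow the successive
  images of a point.\<close>

inductive_set elementary_group :: "complex set \<Rightarrow> (complex ^ 2 ^ 2) set" for R where
  one: "mat 1 \<in> elementary_group R"
| upper: "x \<in> R \<Longrightarrow> A \<in> elementary_group R \<Longrightarrow> upper_elem x ** A \<in> elementary_group R"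
| lower: "x \<in> R \<Longrightarrow> A \<in> elementary_group R \<Longrightarrow> lower_elem x ** A \<in> elementary_group R"

lemma upper_in_elementary_group: "x \<in> R \<Longrightarrow> upper_elem x \<in> elementary_group R"
  and lower_in_elementary_group: "x \<in> R \<Longrightarrow> lower_elem x \<in> elementary_group R"
  using elementary_group.upper[OF _ elementary_group.one] elementary_group.lower[OF _ elementary_group.one]
  by auto

lemma elementary_group_mult:
  assumes "A \<in> elementary_group R" "B \<in> elementary_group R"
  shows "A ** B \<in> elementary_group R"
  using assms(1)
  by induction (auto simp: assms(2) matrix_mul_assoc[symmetric] intro: elementary_group.intros)

lemma det_elementary_group: "A \<in> elementary_group R \<Longrightarrow> det A = 1"
  by (induction rule: elementary_group.induct) (auto simp: det_mul)

context complex_subring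
begin

lemma elementary_group_inv:
  assumes "A \<in> elementary_group R"
  shows "mat2_inv A \<in> elementary_group R"
  using assms
proof induction
  case (upper x A)
  then show ?case
    by (simp add: mat2_inv_mult elementary_group_mult upper_in_elementary_group)
next
  case (lower x A)
  then show ?case
    by (simp add: mat2_inv_mult elementary_group_mult lower_in_elementary_group)
qed (simp add: elementary_group.one)

lemma carrier_SL2: "A \<in> carrier (SL2 R) \<longleftrightarrow> (\<forall>i j. A $ i $ j \<in> R) \<and> det A = 1"
  by (simp add: SL2_def mat_group_def)

lemma mult_SL2 [simp]: "A \<otimes>\<^bsub>SL2 R\<^esub> B = A ** B"
  and one_SL2 [simp]: "\<one>\<^bsub>SL2 R\<^esub> = mat 1"
  by (simp_all add: SL2_def mat_group_def)

lemma uminus_in_SL2: "A \<in> carrier (SL2 R) \<Longrightarrow> - A \<in> carrier (SL2 R)"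
  by (simp add: carrier_SL2 det_2)

lemma mat2_inv_in_SL2: "A \<in> carrier (SL2 R) \<Longrightarrow> mat2_inv A \<in> carrier (SL2 R)"
  unfolding carrier_SL2 det_mat2_inv by (simp add: forall_2 mat2_inv_def)

lemma elementary_group_subset_SL2: "elementary_group R \<subseteq> carrier (SL2 R)"
proof
  fix A assume "A \<in> elementary_group R"
  then show "A \<in> carrier (SL2 R)"
    by induction (auto simp: carrier_SL2 det_mul forall_2)
qed

lemma group_SL2: "group (SL2 R)"
proof (rule groupI)
  fix A assume "A \<in> carrier (SL2 R)"
  then show "\<exists>B\<in>carrier (SL2 R). B \<otimes>\<^bsub>SL2 R\<^esub> A = \<one>\<^bsub>SL2 R\<^esub>"
    using mat2_inv_in_SL2 mat2_inv(2) carrier_SL2 by (metis mult_SL2 one_SL2)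
qed (auto simp: carrier_SL2 det_mul forall_2 matrix_mul_assoc)

lemma inv_SL2: "A \<in> carrier (SL2 R) \<Longrightarrow> inv\<^bsub>SL2 R\<^esub> A = mat2_inv A"
  using group.inv_equality[OF group_SL2, of "mat2_inv A" A] mat2_inv_in_SL2
  by (simp add: carrier_SL2 mat2_inv)

lemma pm_one_coset: "pm_one #>\<^bsub>SL2 R\<^esub> A = {A, - A}"
  by (auto simp: r_coset_def)

lemma normal_pm_one: "pm_one \<lhd> SL2 R"
proof -
  have one: "mat 1 \<in> carrier (SL2 R)"
    by (simp add: carrier_SL2 forall_2)
  have "subgroup pm_one (SL2 R)"
    by (rule group.subgroupI[OF group_SL2])
      (use one uminus_in_SL2[OF one] in \<open>auto simp: inv_SL2 mat2_inv_def intro!: mat2_eqI\<close>)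
  moreover have "pm_one #>\<^bsub>SL2 R\<^esub> A = A <#\<^bsub>SL2 R\<^esub> pm_one" for A
    by (auto simp: r_coset_def l_coset_def)
  ultimately show ?thesis
    by (intro group.normalI[OF group_SL2]) auto
qed

lemma PSL2_mult:
  assumes "A \<in> carrier (SL2 R)" "B \<in> carrier (SL2 R)"
  shows "{A, - A} \<otimes>\<^bsub>PSL2 R\<^esub> {B, - B} = {A ** B, - (A ** B)}"
  using normal.rcos_sum[OF normal_pm_one assms] by (simp add: PSL2_def pm_one_coset)

lemma PSL2_inv:
  assumes "A \<in> carrier (SL2 R)"
  shows "inv\<^bsub>PSL2 R\<^esub> {A, - A} = {mat2_inv A, - mat2_inv A}"
proof -
  have "{A, - A} \<in> carrier (PSL2 R)"
    unfolding PSL2_def FactGroup_def RCOSETS_def using assms pm_one_coset by auto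
  then show ?thesis
    using normal.inv_FactGroup[OF normal_pm_one] normal.rcos_inv[OF normal_pm_one assms]
    by (simp add: PSL2_def pm_one_coset inv_SL2 assms)
qed

text \<open>Passes from the generated subgroup of the quotient to honest matrices: generators and
  their inverses are classes of elementary matrices, and classes multiply through
  representatives.\<close>

lemma E2_eq: "E2 R = (\<lambda>A. {A, - A}) ` elementary_group R"
proof -
  let ?S = "(\<lambda>A. {A, - A}) ` elementary_matrices R"
  have E2: "E2 R = generate (PSL2 R) ?S"
    unfolding E2_def pm_one_coset ..
  have SL2: "A \<in> carrier (SL2 R)" if "A \<in> elementary_group R" for A
    using that elementary_group_subset_SL2 by blast
  have elem: "A \<in> elementary_group R" if "A \<in> elementary_matrices R" for A
    using that upper_in_elementary_group lower_in_elementary_group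
    by (auto simp: elementary_matrices_eq)
  show ?thesis
  proof (intro equalityI subsetI)
    fix C assume "C \<in> E2 R"
    then have "C \<in> generate (PSL2 R) ?S" by (simp add: E2)
    then show "C \<in> (\<lambda>A. {A, - A}) ` elementary_group R"
    proof induction
      case one
      have "\<one>\<^bsub>PSL2 R\<^esub> = {mat 1, - mat 1}" by (simp add: PSL2_def)
      then show ?case using elementary_group.one by blast
    next
      case (incl C)
      then show ?case using elem by blast
    next
      case (inv C)
      then obtain A where "C = {A, - A}" "A \<in> elementary_group R" using elem by blast
      then show ?case using PSL2_inv[OF SL2] elementary_group_inv by blast
    next
      case (eng C D)
      then obtain A B where "C = {A, - A}" "A \<in> elementary_group R"
        "D = {B, - B}" "B \<in> elementary_group R" by blast
      then show ?case using PSL2_mult[OF SL2 SL2] elementary_group_mult by blast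
    qed
  next
    have gen: "{A ** B, - (A ** B)} \<in> E2 R"
      if "A \<in> elementary_matrices R" "B \<in> elementary_group R" "{B, - B} \<in> E2 R" for A B
    proof -
      have "{A, - A} \<in> E2 R" unfolding E2 using that by (intro generate.incl) blast
      then show ?thesis
        using that PSL2_mult[OF SL2 SL2, of A B] elem generate.eng[of "{A, - A}" "PSL2 R" ?S "{B, - B}"]
        unfolding E2 by simp
    qed
    fix C assume "C \<in> (\<lambda>A. {A, - A}) ` elementary_group R"
    then obtain A where C: "C = {A, - A}" and "A \<in> elementary_group R" by blast
    from this(2) have "{A, - A} \<in> E2 R"
    proof induction
      case one
      have "\<one>\<^bsub>PSL2 R\<^esub> = {mat 1, - mat 1}" by (simp add: PSL2_def)
      then show ?case using generate.one[of "PSL2 R" ?S] unfolding E2 by simp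
    qed (auto intro!: gen simp: elementary_matrices_eq)
    then show "C \<in> E2 R" using C by simp
  qed
qed

text \<open>Both representatives of a class act alike, so \<open>the_elem\<close> is applied to a
  singleton.\<close>

lemma psl_action_E2: "psl_action \<tau> ` E2 R = herm_action \<tau> ` elementary_group R"
  by (simp add: E2_eq image_image psl_action_def herm_action_uminus)

end

section \<open>Orbits of points under the elementary group\<close>

context discretely_normed_ring
begin

text \<open>The Moebius action in homogeneous coordinates: the vector (c z, c) is sent to (d w, d).
  Carrying d \<noteq> 0 through the induction records that no image of z is infinite.\<close>

lemma elementary_group_reduced_orbit:
  assumes z: "far_from_ring z" and "A \<in> elementary_group R" and "c \<noteq> 0"
  obtains d w where "d \<noteq> 0" "w \<in> reduced_orbit z"
    "A $ 1 $ 1 * (c * z) + A $ 1 $ 2 * c = d * w" "A $ 2 $ 1 * (c * z) + A $ 2 $ 2 * c = d"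
proof -
  have "\<exists>d w. d \<noteq> 0 \<and> w \<in> reduced_orbit z \<and>
    A $ 1 $ 1 * (c * z) + A $ 1 $ 2 * c = d * w \<and> A $ 2 $ 1 * (c * z) + A $ 2 $ 2 * c = d"
    using assms(2)
  proof induction
    case one
    then show ?case
      using \<open>c \<noteq> 0\<close> reduced_orbit_self by (intro exI[of _ c] exI[of _ z]) auto
  next
    case (upper x A)
    then obtain d w where dw: "d \<noteq> 0" "w \<in> reduced_orbit z"
      "A $ 1 $ 1 * (c * z) + A $ 1 $ 2 * c = d * w" "A $ 2 $ 1 * (c * z) + A $ 2 $ 2 * c = d"
      by blast
    have "(upper_elem x ** A) $ 1 $ 1 * (c * z) + (upper_elem x ** A) $ 1 $ 2 * c =
      (A $ 1 $ 1 * (c * z) + A $ 1 $ 2 * c) + x * (A $ 2 $ 1 * (c * z) + A $ 2 $ 2 * c)"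
      by (simp add: algebra_simps)
    also have "\<dots> = d * (x + w)"
      unfolding dw(3,4) by (simp add: algebra_simps)
    finally show ?case
      using dw reduced_orbit_add[OF dw(2) upper.hyps(1)]
      by (intro exI[of _ d] exI[of _ "x + w"]) simp
  next
    case (lower x A)
    then obtain d w where dw: "d \<noteq> 0" "w \<in> reduced_orbit z"
      "A $ 1 $ 1 * (c * z) + A $ 1 $ 2 * c = d * w" "A $ 2 $ 1 * (c * z) + A $ 2 $ 2 * c = d"
      by blast
    \<comment> \<open>The lower elementary matrix sends w to w / (x w + 1), which is - 1 / v, that
      is, an inversion, the translation by - x and another inversion. The new denominator d (x w +
      1) equals - d w v.\<close>
    define v where "v = - x + - inverse w"
    have v: "v \<in> reduced_orbit z"
      unfolding v_def by (intro reduced_orbit_add reduced_orbit_inverse[OF z] dw uminus_closed lower.hyps)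
    have nz: "w \<noteq> 0" "v \<noteq> 0"
      using reduced_orbit_nonzero[OF z] dw v by auto
    have "(lower_elem x ** A) $ 2 $ 1 * (c * z) + (lower_elem x ** A) $ 2 $ 2 * c =
      x * (A $ 1 $ 1 * (c * z) + A $ 1 $ 2 * c) + (A $ 2 $ 1 * (c * z) + A $ 2 $ 2 * c)"
      by (simp add: algebra_simps)
    also have "\<dots> = - d * w * v"
      unfolding dw(3,4) using nz by (simp add: v_def algebra_simps)
    finally have "(lower_elem x ** A) $ 2 $ 1 * (c * z) + (lower_elem x ** A) $ 2 $ 2 * c = - d * w * v" .
    moreover have "(lower_elem x ** A) $ 1 $ 1 * (c * z) + (lower_elem x ** A) $ 1 $ 2 * c =
      - d * w * v * (- inverse v)"
      using dw(3) nz by simp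
    ultimately show ?case
      using nz dw(1) reduced_orbit_inverse[OF z v]
      by (intro exI[of _ "- d * w * v"] exI[of _ "- inverse v"]) simp
  qed
  then show ?thesis using that by blast
qed

end

subsection \<open>Zariski closure\<close>

lemma real_polynomial_function_eq_0_if_Ints:
  fixes f :: "real \<Rightarrow> real"
  assumes "real_polynomial_function f" "\<And>n :: int. f (of_int n) = 0"
  shows "f x = 0"
proof -
  obtain a n where f: "f = (\<lambda>x. \<Sum>i\<le>n. a i * x ^ i)"
    using assms(1) real_polynomial_function_iff_sum by blast
  have "infinite (range real_of_int)"
    by (simp add: finite_image_iff inj_on_def)
  moreover have "range real_of_int \<subseteq> {x. (\<Sum>i\<le>n. a i * x ^ i) = 0}"
    using assms(2) f by auto
  ultimately have "infinite {x. (\<Sum>i\<le>n. a i * x ^ i) = 0}"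
    using finite_subset by blast
  then have "\<forall>i\<le>n. a i = 0"
    using Poly_Roots.polyfun_finite_roots[of a n] by blast
  then show ?thesis by (simp add: f)
qed

text \<open>Restricting p to a curve that is quadratic in s gives a polynomial in one variable, for
  which vanishing at all integers is decisive.\<close>

lemma real_polynomial_function_quadratic_curve:
  fixes p :: "real ^ 'n ^ 'n \<Rightarrow> real"
  assumes "real_polynomial_function p"
  shows "real_polynomial_function (\<lambda>s. p (A ** (P + s *\<^sub>R Q + s\<^sup>2 *\<^sub>R S) ** B))"
proof -
  have "A ** (P + s *\<^sub>R Q + s\<^sup>2 *\<^sub>R S) ** B =
      A ** P ** B + s *\<^sub>R (A ** Q ** B) + s\<^sup>2 *\<^sub>R (A ** S ** B)" for s
    by (simp add: vec_eq_iff matrix_matrix_mult_def sum_distrib_left sum_distrib_right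
        sum.distrib algebra_simps)
  moreover have "polynomial_function (\<lambda>s. A ** P ** B + s *\<^sub>R (A ** Q ** B) + s *\<^sub>R (s *\<^sub>R (A ** S ** B)))"
    by (intro polynomial_function_add polynomial_function_const polynomial_function_mult
        polynomial_function_id)
  ultimately have "polynomial_function (\<lambda>s. A ** (P + s *\<^sub>R Q + s\<^sup>2 *\<^sub>R S) ** B)"
    by (simp add: power2_eq_square)
  from real_polynomial_function_compose[OF this assms] show ?thesis
    by (simp add: o_def)
qed

text \<open>Expand the product of 1 + s N, Y and the conjugate transpose of 1 + s N for real s. The
  quadratic coefficient is again of the form \<open>herm_action\<close>, now applied to a matrix
  that may be singular.\<close>

lemma herm_action_one_parameter:
  assumes "Im \<tau> \<noteq> 0"
  shows "herm_action \<tau> (mat 1 + s *\<^sub>R N) =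
    mat 1 + s *\<^sub>R herm_map \<tau> (\<lambda>Y. N ** Y + Y ** conj_transpose N) + s\<^sup>2 *\<^sub>R herm_action \<tau> N"
  unfolding matrix_eq
proof
  fix v
  let ?H = "herm \<tau> v"
  have lin: "linear (\<lambda>Y. N ** Y + Y ** conj_transpose N)"
    by (rule linearI; rule mat2_eqI) (simp_all add: algebra_simps)
  have "(mat 1 + s *\<^sub>R N) ** ?H ** conj_transpose (mat 1 + s *\<^sub>R N) =
    ?H + s *\<^sub>R (N ** ?H + ?H ** conj_transpose N) + s\<^sup>2 *\<^sub>R (N ** ?H ** conj_transpose N)"
    by (rule mat2_eqI)
      (simp_all add: mat_def scaleR_conv_of_real[where 'a = complex] algebra_simps power2_eq_square)
  then show "herm_action \<tau> (mat 1 + s *\<^sub>R N) *v v =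
      (mat 1 + s *\<^sub>R herm_map \<tau> (\<lambda>Y. N ** Y + Y ** conj_transpose N) + s\<^sup>2 *\<^sub>R herm_action \<tau> N) *v v"
    by (simp add: herm_action_mult_vec[OF assms] herm_map_mult[OF lin] matrix_vector_mult_add_rdistrib
        scaleR_matrix_vector_assoc[symmetric] linear_add[OF linear_unherm] linear_scale[OF linear_unherm] assms)
qed

text \<open>The closure in the space of all matrices. Splitting off the ambient group lets the
  density argument ignore membership in it.\<close>

definition zariski_vanishing :: "(real ^ 'n ^ 'n) set \<Rightarrow> (real ^ 'n ^ 'n) set" where
  "zariski_vanishing \<Gamma> = {A. \<forall>p. real_polynomial_function p \<and> (\<forall>B\<in>\<Gamma>. p B = 0) \<longrightarrow> p A = 0}"

lemma zariski_closure_eq: "zariski_closure H \<Gamma> = H \<inter> zariski_vanishing \<Gamma>"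
  unfolding zariski_closure_def zariski_vanishing_def by blast

lemma zariski_vanishing_one_parameter:
  fixes A N B :: "complex ^ 2 ^ 2"
  assumes \<tau>: "Im \<tau> \<noteq> 0"
    and int: "\<And>n :: int. herm_action \<tau> (A ** (mat 1 + of_int n *\<^sub>R N) ** B) \<in> zariski_vanishing \<Gamma>"
  shows "herm_action \<tau> (A ** (mat 1 + s *\<^sub>R N) ** B) \<in> zariski_vanishing \<Gamma>"
  unfolding zariski_vanishing_def
proof safe
  fix p :: "real ^ 4 ^ 4 \<Rightarrow> real"
  assume p: "real_polynomial_function p" "\<forall>B\<in>\<Gamma>. p B = 0"
  let ?f = "\<lambda>s. p (herm_action \<tau> (A ** (mat 1 + s *\<^sub>R N) ** B))"
  have "real_polynomial_function ?f"
    unfolding herm_action_mult[OF \<tau>] herm_action_one_parameter[OF \<tau>]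
    by (rule real_polynomial_function_quadratic_curve[OF p(1)])
  moreover have "?f (of_int n) = 0" for n
    using int[of n] p unfolding zariski_vanishing_def by blast
  ultimately show "?f s = 0"
    by (rule real_polynomial_function_eq_0_if_Ints)
qed

lemma upper_elem_scaled: "upper_elem (of_real s * \<omega>) = mat 1 + s *\<^sub>R vector [vector [0, \<omega>], vector [0, 0]]"
  by (rule mat2_eqI) (simp_all add: scaleR_conv_of_real[where 'a = complex])

text \<open>As 1 and \<tau> span the complex numbers over the reals, two one-parameter arguments
  suffice: first the coefficient of 1 becomes real with that of \<tau> still an integer, then the
  coefficient of \<tau> does.\<close>

lemma zariski_vanishing_upper_elem:
  assumes "Im \<tau> \<noteq> 0"
    and "\<And>m n. herm_action \<tau> (A ** upper_elem (of_int m + of_int n * \<tau>) ** B) \<in> zariski_vanishing \<Gamma>"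
  shows "herm_action \<tau> (A ** upper_elem u ** B) \<in> zariski_vanishing \<Gamma>"
proof -
  have line: "herm_action \<tau> (A ** upper_elem (of_real s * \<omega>) ** B) \<in> zariski_vanishing \<Gamma>"
    if "\<And>n :: int. herm_action \<tau> (A ** upper_elem (of_int n * \<omega>) ** B) \<in> zariski_vanishing \<Gamma>"
    for A B \<omega> s
    unfolding upper_elem_scaled
  proof (rule zariski_vanishing_one_parameter[OF assms(1)])
    fix n :: int
    show "herm_action \<tau> (A ** (mat 1 + of_int n *\<^sub>R vector [vector [0, \<omega>], vector [0, 0]]) ** B)
        \<in> zariski_vanishing \<Gamma>"
      using that[of n] upper_elem_scaled[of "of_int n" \<omega>] by simp
  qed
  have "herm_action \<tau> (A ** upper_elem (of_int n * \<tau>) ** upper_elem (of_real s * 1) ** B)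
      \<in> zariski_vanishing \<Gamma>" for n :: int and s
  proof (rule line)
    fix m :: int
    show "herm_action \<tau> (A ** upper_elem (of_int n * \<tau>) ** upper_elem (of_int m * 1) ** B)
        \<in> zariski_vanishing \<Gamma>"
      using assms(2)[of m n] upper_elem_add[of "of_int n * \<tau>" "of_int m"]
      by (simp add: add.commute matrix_mul_assoc)
  qed
  then have "herm_action \<tau> (A ** upper_elem (of_real t * \<tau>) ** (upper_elem (of_real s * 1) ** B))
      \<in> zariski_vanishing \<Gamma>" for s t
    by (intro line) (simp add: matrix_mul_assoc)
  moreover have u: "u = of_real (Im u / Im \<tau>) * \<tau> + of_real (Re u - Im u / Im \<tau> * Re \<tau>) * 1"
    using assms(1) by (simp add: complex_eq_iff)
  ultimately have "herm_action \<tau> (A ** (upper_elem (of_real t * \<tau>) ** upper_elem (of_real s * 1)) ** B)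
      \<in> zariski_vanishing \<Gamma>" for s t
    by (simp add: matrix_mul_assoc)
  then show ?thesis
    by (subst u) (simp only: upper_elem_add)
qed

text \<open>The right factor is freed from R while the left one still lies in R; then the left one
  is freed for an arbitrary right factor.\<close>

lemma zariski_vanishing_elementary_group:
  assumes \<tau>: "Im \<tau> \<noteq> 0" and R: "\<And>m n :: int. of_int m + of_int n * \<tau> \<in> R"
    and L: "L \<in> elementary_group R"
  shows "herm_action \<tau> (upper_elem u ** L ** upper_elem w)
    \<in> zariski_vanishing (herm_action \<tau> ` elementary_group R)" (is "_ \<in> ?Z")
proof -
  have "herm_action \<tau> (upper_elem x ** L ** upper_elem y) \<in> ?Z" if "x \<in> R" "y \<in> R" for x y
    using that L unfolding zariski_vanishing_def
    by (auto intro: elementary_group_mult upper_in_elementary_group)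
  then have "herm_action \<tau> (upper_elem x ** L ** upper_elem w ** mat 1) \<in> ?Z" if "x \<in> R" for x
    using that R by (simp add: zariski_vanishing_upper_elem[OF \<tau>, where B = "mat 1", simplified])
  then have "herm_action \<tau> (mat 1 ** upper_elem x ** (L ** upper_elem w)) \<in> ?Z" if "x \<in> R" for x
    using that by (simp add: matrix_mul_assoc)
  then have "herm_action \<tau> (mat 1 ** upper_elem u ** (L ** upper_elem w)) \<in> ?Z"
    by (rule zariski_vanishing_upper_elem[OF \<tau>]) (use R in blast)
  then show ?thesis
    by (simp add: matrix_mul_assoc)
qed

text \<open>The parameter of the middle factor is the lower left entry itself. For A with entries in
  R the middle factor is thus elementary over R, and only the outer factors, where arbitrary complex
  parameters are allowed, leave R.\<close>

lemma upper_lower_upper_factorization: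
  assumes "det A = 1" "A $ 2 $ 1 \<noteq> 0"
  shows "A = upper_elem ((A $ 1 $ 1 - 1) / A $ 2 $ 1) ** lower_elem (A $ 2 $ 1) **
    upper_elem ((A $ 2 $ 2 - 1) / A $ 2 $ 1)"
proof (rule mat2_eqI)
  have "A $ 1 $ 2 * A $ 2 $ 1 = A $ 1 $ 1 * A $ 2 $ 2 - 1"
    using assms(1) by (simp add: det_2 algebra_simps)
  then show "A $ 1 $ 2 = (upper_elem ((A $ 1 $ 1 - 1) / A $ 2 $ 1) ** lower_elem (A $ 2 $ 1) **
    upper_elem ((A $ 2 $ 2 - 1) / A $ 2 $ 1)) $ 1 $ 2"
    using assms(2) by (simp add: field_simps)
qed (use assms(2) in simp_all)

subsection \<open>Infinite index\<close>

text \<open>The bound is - \<Delta> / 4 for the discriminant \<Delta> = - 15; more negative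
  discriminants give larger values.\<close>

locale imaginary_quadratic_order =
  fixes R :: "complex set" and \<tau> :: complex and t N :: int
  assumes R_eq: "R = {of_int m + of_int n * \<tau> |m n. True}"
    and trace: "\<tau> + cnj \<tau> = of_int t" and norm: "\<tau> * cnj \<tau> = of_int N"
    and Im_\<tau>_ge: "15 / 4 \<le> (Im \<tau>)\<^sup>2"
begin

lemma Im_\<tau>_nonzero: "Im \<tau> \<noteq> 0"
  using Im_\<tau>_ge by auto

text \<open>A decimal just below the square root of 15 / 4, as 1.93 squared is 3.7249.\<close>

lemma abs_Im_\<tau>_gt: "1.93 < \<bar>Im \<tau>\<bar>"
proof (rule power2_less_imp_less)
  show "1.93\<^sup>2 < \<bar>Im \<tau>\<bar>\<^sup>2"
    using Im_\<tau>_ge by (simp add: power2_eq_square)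
qed simp

lemma R_memI: "of_int m + of_int n * \<tau> \<in> R"
  unfolding R_eq by blast

lemma of_int_in_R: "of_int m \<in> R"
  using R_memI[of m 0] by simp

text \<open>Closure under products comes from \<tau> \<tau> = t \<tau> - N, where t is the trace and
  N the norm of \<tau>.\<close>

sublocale complex_subring R
proof
  show "0 \<in> R" "1 \<in> R"
    using of_int_in_R[of 0] of_int_in_R[of 1] by simp_all
next
  fix x y assume "x \<in> R" "y \<in> R"
  then obtain m n k l where xy: "x = of_int m + of_int n * \<tau>" "y = of_int k + of_int l * \<tau>"
    unfolding R_eq by blast
  show "x + y \<in> R"
    using R_memI[of "m + k" "n + l"] xy by (simp add: algebra_simps)
  have "x * y = of_int (m * k) + of_int (m * l + n * k) * \<tau> + of_int (n * l) * (\<tau> * \<tau>)"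
    unfolding xy by (simp add: algebra_simps)
  also have "\<tau> * \<tau> = of_int t * \<tau> - of_int N"
    unfolding trace[symmetric] norm[symmetric] by (simp add: algebra_simps)
  also have "of_int (m * k) + of_int (m * l + n * k) * \<tau> + of_int (n * l) * (of_int t * \<tau> - of_int N) =
      of_int (m * k - n * l * N) + of_int (m * l + n * k + n * l * t) * \<tau>"
    by (simp add: algebra_simps)
  finally have "x * y = of_int (m * k - n * l * N) + of_int (m * l + n * k + n * l * t) * \<tau>" .
  then show "x * y \<in> R"
    using R_memI by metis
next
  fix x assume "x \<in> R"
  then obtain m n where "x = of_int m + of_int n * \<tau>"
    unfolding R_eq by blast
  then show "- x \<in> R"
    using R_memI[of "- m" "- n"] by simp
qed

lemma cnj_in_R:
  assumes "x \<in> R"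
  shows "cnj x \<in> R"
proof -
  obtain m n where "x = of_int m + of_int n * \<tau>"
    using assms unfolding R_eq by blast
  then have "cnj x = of_int m + of_int n * cnj \<tau>"
    by simp
  also have "cnj \<tau> = of_int t - \<tau>"
    by (simp flip: trace)
  also have "of_int m + of_int n * (of_int t - \<tau>) = of_int (m + n * t) + of_int (- n) * \<tau>"
    by (simp add: algebra_simps)
  finally have "cnj x = of_int (m + n * t) + of_int (- n) * \<tau>" .
  then show ?thesis
    using R_memI by metis
qed

text \<open>The lattice consists of horizontal rows at multiples of Im \<tau>, and only the row of
  the integers is this close to the real axis.\<close>

lemma R_real_imp_int:
  assumes "x \<in> R" "\<bar>Im x\<bar> < 1.93"
  obtains m :: int where "x = of_int m"
proof -
  obtain m n where x: "x = of_int m + of_int n * \<tau>"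
    using assms(1) unfolding R_eq by blast
  have "n = 0"
  proof (rule ccontr)
    assume "n \<noteq> 0"
    then have "1 \<le> \<bar>real_of_int n\<bar>" by simp
    then have "1 * \<bar>Im \<tau>\<bar> \<le> \<bar>real_of_int n\<bar> * \<bar>Im \<tau>\<bar>"
      by (rule mult_right_mono) simp
    then show False
      using assms(2) abs_Im_\<tau>_gt by (simp add: x abs_mult)
  qed
  then show ?thesis using x that by simp
qed

lemma R_trace_norm:
  assumes "x \<in> R"
  obtains k l :: int where "x + cnj x = of_int k" "x * cnj x = of_int l"
proof -
  obtain m n where x: "x = of_int m + of_int n * \<tau>"
    using assms unfolding R_eq by blast
  have "x + cnj x = of_int (2 * m) + of_int n * (\<tau> + cnj \<tau>)"
    by (simp add: x algebra_simps)
  also have "\<dots> = of_int (2 * m + n * t)"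
    by (simp add: trace)
  finally have 1: "x + cnj x = of_int (2 * m + n * t)" .
  have "x * cnj x = of_int (m * m) + of_int (m * n) * (\<tau> + cnj \<tau>) + of_int (n * n) * (\<tau> * cnj \<tau>)"
    by (simp add: x algebra_simps)
  also have "\<dots> = of_int (m * m + m * n * t + n * n * N)"
    by (simp add: trace norm)
  finally have "x * cnj x = of_int (m * m + m * n * t + n * n * N)" .
  with 1 show ?thesis using that by blast
qed

text \<open>Off the real axis the height alone gives only 1.93. But the squared norm is an integer
  greater than 3, hence at least 4.\<close>

sublocale discretely_normed_ring R
proof
  fix x assume x: "x \<in> R" "x \<notin> {0, 1, - 1}"
  show "2 \<le> norm x"
  proof (cases "\<bar>Im x\<bar> < 1.93")
    case True
    then obtain m :: int where m: "x = of_int m"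
      using x R_real_imp_int by blast
    then have "m \<notin> {0, 1, - 1}"
      using x by auto
    then have "2 \<le> \<bar>m\<bar>" by auto
    then show ?thesis by (simp add: m)
  next
    case False
    obtain l where l: "x * cnj x = of_int l"
      using x R_trace_norm by blast
    then have norm_l: "(norm x)\<^sup>2 = of_int l"
      using complex_norm_square[of x] by (metis of_real_eq_iff of_real_of_int_eq)
    have "1.93\<^sup>2 \<le> \<bar>Im x\<bar>\<^sup>2"
      using False by (intro power_mono) auto
    also have "\<dots> \<le> (norm x)\<^sup>2"
      using abs_Im_le_cmod by (intro power_mono) auto
    finally have "3 < (of_int l :: real)"
      unfolding norm_l by (simp add: power2_eq_square)
    then have "2\<^sup>2 \<le> (norm x)\<^sup>2"
      unfolding norm_l by simp
    then show ?thesis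
      by (rule power2_le_imp_le) simp
  qed
qed

text \<open>A square around \<open>1/2 + 9/10 i\<close>: high enough to be far from the integers, and low enough that the
  other rows of the lattice \<open>R\<close>, which are at least \<open>\<bar>Im \<tau>\<bar> > 1.93\<close> away from the real axis, are far too.\<close>

definition hole :: "complex set" where
  "hole = {z. 0.49 \<le> Re z \<and> Re z \<le> 0.51 \<and> 0.89 \<le> Im z \<and> Im z \<le> 0.91}"

text \<open>For an integer q the squared distance is at least 0.49 squared plus 0.89 squared, which
  is 1.0322. Other q differ from z in imaginary part by at least 1.93 - 0.91 = 1.02.\<close>

lemma hole_far:
  assumes "z \<in> hole"
  shows "far_from_ring z"
  unfolding far_from_ring_def
proof
  fix q assume q: "q \<in> R"
  show "1 < norm (z - q)"
  proof (cases "\<bar>Im q\<bar> < 1.93")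
    case True
    then obtain m :: int where m: "q = of_int m"
      using q R_real_imp_int by blast
    have "m \<le> 0 \<or> 1 \<le> m" by linarith
    then have "0.49 \<le> \<bar>Re z - of_int m\<bar>"
    proof
      assume "m \<le> 0"
      then have "real_of_int m \<le> 0" by simp
      then show ?thesis using assms by (simp add: hole_def)
    next
      assume "1 \<le> m"
      then have "1 \<le> real_of_int m" by simp
      then show ?thesis using assms by (simp add: hole_def)
    qed
    then have "0.49\<^sup>2 \<le> \<bar>Re z - of_int m\<bar>\<^sup>2"
      by (intro power_mono) auto
    moreover have "0.89\<^sup>2 \<le> (Im z)\<^sup>2"
      using assms by (intro power_mono) (auto simp: hole_def)
    ultimately have "1\<^sup>2 < (Re z - of_int m)\<^sup>2 + (Im z)\<^sup>2"
      by (simp add: power2_eq_square)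
    then have "1\<^sup>2 < (norm (z - q))\<^sup>2"
      by (simp add: cmod_power2 m)
    then show ?thesis
      by (rule power2_less_imp_less) simp
  next
    case False
    then have "1 < \<bar>Im (z - q)\<bar>"
      using assms by (auto simp: hole_def)
    then show ?thesis
      using abs_Im_le_cmod[of "z - q"] by linarith
  qed
qed

lemma hole_diff_eq_0:
  assumes "z \<in> hole" "w \<in> hole" "w - z \<in> R"
  shows "w = z"
proof -
  have "\<bar>Im (w - z)\<bar> < 1.93"
    unfolding abs_less_iff using assms(1,2) by (simp add: hole_def)
  then obtain m :: int where m: "w - z = of_int m"
    using R_real_imp_int[OF assms(3)] by auto
  then have "Re w - Re z = of_int m"
    by (metis Re_complex_of_real minus_complex.simps(1) of_real_of_int_eq)
  then have "\<bar>real_of_int m\<bar> < 1"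
    using assms by (auto simp: hole_def)
  then have "m = 0" by linarith
  then show ?thesis using m by simp
qed

section \<open>Dyadic points in the orbit of infinity\<close>

lemma half_notin_R: "x \<in> R \<Longrightarrow> 2 * x \<noteq> 1"
proof
  assume x: "x \<in> R" "2 * x = 1"
  then have "Im x = 0"
    by (auto simp: complex_eq_iff)
  then obtain m :: int where "x = of_int m"
    using R_real_imp_int[OF x(1)] by auto
  then have "of_int (2 * m) = (of_int 1 :: complex)"
    using x by simp
  then have "2 * m = 1"
    by (simp only: of_int_eq_iff)
  then show False by presburger
qed

text \<open>The numerator 1 + 2 r is never divisible by 2 in R, so the fraction determines the
  exponent of its denominator.\<close>

lemma dyadic_fractions_inj:
  assumes "r \<in> R" "s \<in> R" "(1 + 2 * r) / 2 ^ k = (1 + 2 * s) / 2 ^ l"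
  shows "k = l"
proof -
  have False if "r \<in> R" "s \<in> R" "(1 + 2 * r) / 2 ^ k = (1 + 2 * s) / 2 ^ l" "k < l" for r s k l
  proof -
    from \<open>k < l\<close> obtain d where l: "l = Suc (k + d)"
      using less_imp_Suc_add by blast
    have "2 * (2 ^ d * (1 + 2 * r)) = 1 + 2 * s"
      using that(3) by (simp add: l field_simps power_add)
    then have "2 * (2 ^ d * (1 + 2 * r) - s) = 1"
      by (simp add: algebra_simps)
    moreover have "2 ^ d * (1 + 2 * r) - s \<in> R"
      using that of_int_in_R[of "2 ^ d"] of_int_in_R[of 2] by auto
    ultimately show False
      using half_notin_R by blast
  qed
  from this[OF assms] this[OF assms(2,1) assms(3)[symmetric]] show ?thesis
    by (meson linorder_neqE_nat)
qed

lemma eventually_dyadic_fraction_in_hole: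
  obtains k\<^sub>0 where "\<And>k. k\<^sub>0 \<le> k \<Longrightarrow> \<exists>r\<in>R. (1 + 2 * r) / 2 ^ k \<in> hole"
proof -
  \<comment> \<open>From here on the rounding errors, at most 1 horizontally and \<bar>Im
    \<tau>\<bar> vertically, are at most a hundredth of \<open>2 ^ k\<close>, half the side of the
    square after scaling.\<close>
  obtain k\<^sub>0 where k\<^sub>0: "100 + 100 * \<bar>Im \<tau>\<bar> < 2 ^ k\<^sub>0"
    using real_arch_pow[of 2] by auto
  have "\<exists>r\<in>R. (1 + 2 * r) / 2 ^ k \<in> hole" if "k\<^sub>0 \<le> k" for k
  proof -
    define c :: real where "c = 2 ^ k"
    have "2 ^ k\<^sub>0 \<le> c"
      unfolding c_def using that by (intro power_increasing) auto
    then have c: "100 \<le> c" "100 * \<bar>Im \<tau>\<bar> \<le> c"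
      using k\<^sub>0 by linarith+
    have c_pos: "0 < c" using c by linarith
    \<comment> \<open>The target is the centre 1/2 + 9/10 i, scaled by c. The imaginary part fixes
      n; the real part, shifted by n Re \<tau>, is then corrected by m.\<close>
    obtain n :: int where "\<bar>0.9 * c / (2 * Im \<tau>) - of_int n\<bar> \<le> 1/2"
      using of_int_round_abs_le by (metis abs_minus_commute)
    then have "\<bar>0.9 * c / (2 * Im \<tau>) - of_int n\<bar> * (2 * \<bar>Im \<tau>\<bar>) \<le> 1/2 * (2 * \<bar>Im \<tau>\<bar>)"
      by (intro mult_right_mono) auto
    also have "\<bar>0.9 * c / (2 * Im \<tau>) - of_int n\<bar> * (2 * \<bar>Im \<tau>\<bar>) =
        \<bar>(0.9 * c / (2 * Im \<tau>) - of_int n) * (2 * Im \<tau>)\<bar>"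
      by (simp add: abs_mult)
    also have "(0.9 * c / (2 * Im \<tau>) - of_int n) * (2 * Im \<tau>) = 0.9 * c - 2 * of_int n * Im \<tau>"
      using Im_\<tau>_nonzero by (simp add: field_simps)
    finally have n: "\<bar>0.9 * c - 2 * of_int n * Im \<tau>\<bar> \<le> 0.01 * c"
      using c by simp
    define x where "x = 1 + 2 * of_int n * Re \<tau>"
    obtain m :: int where "\<bar>(0.5 * c - x) / 2 - of_int m\<bar> \<le> 1/2"
      using of_int_round_abs_le by (metis abs_minus_commute)
    then have m: "\<bar>0.5 * c - (x + 2 * of_int m)\<bar> \<le> 0.01 * c"
      using c unfolding abs_le_iff by (intro conjI; simp add: field_simps)
    let ?r = "of_int m + of_int n * \<tau>"
    have eq: "(1 + 2 * ?r) / 2 ^ k = (1 + 2 * ?r) / of_real c"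
      by (simp add: c_def)
    have Re_Im: "Re ((1 + 2 * ?r) / 2 ^ k) = (x + 2 * of_int m) / c"
      "Im ((1 + 2 * ?r) / 2 ^ k) = (2 * of_int n * Im \<tau>) / c"
      unfolding eq by (simp_all add: x_def Re_divide_of_real Im_divide_of_real algebra_simps)
    then have "(1 + 2 * ?r) / 2 ^ k \<in> hole"
      unfolding hole_def mem_Collect_eq Re_Im using n m c_pos unfolding abs_le_iff
      by (intro conjI; simp add: field_simps)
    then show ?thesis using R_memI by blast
  qed
  then show ?thesis using that by blast
qed

text \<open>The norm of p = 1 + 2 r is an odd integer, hence coprime to \<open>2 ^ k\<close>. An
  integral Bezout relation between the two completes the column, since the norm is the multiple
  \<open>p * cnj p\<close> of p.\<close>

lemma integral_matrix_with_first_column: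
  assumes "r \<in> R"
  obtains A where "A \<in> carrier (SL2 R)" "A $ 1 $ 1 = 1 + 2 * r" "A $ 2 $ 1 = 2 ^ k"
proof -
  define p where "p = 1 + 2 * r"
  obtain a b where ab: "r + cnj r = of_int a" "r * cnj r = of_int b"
    using assms R_trace_norm by blast
  have "p * cnj p = 1 + 2 * (r + cnj r) + 4 * (r * cnj r)"
    by (simp add: p_def algebra_simps)
  then have pp: "p * cnj p = of_int (1 + 2 * a + 4 * b)"
    unfolding ab by simp
  have "coprime (1 + 2 * a + 4 * b) (2 ^ k)"
    by (simp add: coprime_right_2_iff_odd)
  then obtain u v where uv: "u * (1 + 2 * a + 4 * b) + v * 2 ^ k = 1"
    using bezout_int[of "1 + 2 * a + 4 * b" "2 ^ k"] by (auto simp: coprime_iff_gcd_eq_1)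
  define A :: "complex ^ 2 ^ 2" where
    "A = vector [vector [p, - of_int v], vector [2 ^ k, of_int u * cnj p]]"
  have "det A = of_int u * (p * cnj p) + of_int (v * 2 ^ k)"
    by (simp add: A_def det_2 algebra_simps)
  also have "\<dots> = of_int (u * (1 + 2 * a + 4 * b) + v * 2 ^ k)"
    unfolding pp by simp
  finally have "det A = 1" using uv by simp
  moreover have p: "p \<in> R"
    unfolding p_def using assms of_int_in_R[of 2] by auto
  moreover have "- of_int v \<in> R" "2 ^ k \<in> R" "of_int u * cnj p \<in> R"
    using of_int_in_R[of "2 ^ k"] of_int_in_R cnj_in_R[OF p] by simp_all
  ultimately have "A \<in> carrier (SL2 R)"
    by (simp add: carrier_SL2 forall_2 A_def)
  then show ?thesis
    by (rule that) (simp_all add: A_def p_def)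
qed

text \<open>Columns are images of basis vectors, which stand for Hermitian matrices over R. The
  action keeps the entries in R, real elements of R are integers, and coordinates with respect to 1
  and \<tau> are unique.\<close>

lemma herm_action_integral:
  assumes "A \<in> carrier (SL2 R)"
  shows "herm_action \<tau> A $ i $ j \<in> \<int>"
proof -
  let ?v = "axis j 1 :: real ^ 4" and ?w = "herm_action \<tau> A *v axis j 1"
  have A: "A $ k $ l \<in> R" for k l
    using assms by (simp add: carrier_SL2)
  have "axis j 1 $ k = 0 \<or> axis j 1 $ k = (1 :: real)" for k
    by (simp add: axis_def)
  then have v: "of_real (?v $ k) \<in> R" for k
    by (metis of_real_0 of_real_1 zero_closed one_closed)
  have tau: "\<tau> \<in> R" "cnj \<tau> \<in> R"
    using R_memI[of 0 1] cnj_in_R by auto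
  have "herm \<tau> ?v $ k $ l \<in> R" for k l
    using exhaust_2[of k] exhaust_2[of l] v tau by auto
  moreover have "(A ** M ** conj_transpose A) $ k $ l \<in> R" if "\<And>k l. M $ k $ l \<in> R" for M k l
    using A cnj_in_R that by simp
  ultimately have "(A ** herm \<tau> ?v ** conj_transpose A) $ k $ l \<in> R" for k l
    by blast
  then have H: "herm \<tau> ?w $ k $ l \<in> R" for k l
    by (simp add: herm_herm_action[OF Im_\<tau>_nonzero])
  have diag: "x \<in> \<int>" if x: "complex_of_real x \<in> R" for x
  proof -
    obtain m :: int where "complex_of_real x = of_int m"
      using R_real_imp_int[OF x] by auto
    then have "x = of_int m"
      by (metis of_real_eq_iff of_real_of_int_eq)
    then show ?thesis by simp
  qed
  obtain m n where "of_real (?w $ 3) + of_real (?w $ 4) * \<tau> = of_int m + of_int n * \<tau>"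
    using H[of 1 2] unfolding R_eq by auto
  then have "?w $ 4 = of_int n" "?w $ 3 = of_int m"
    using Im_\<tau>_nonzero by (auto simp: complex_eq_iff)
  then have "?w $ k \<in> \<int>" for k
    using exhaust_4[of k] H[of 1 1] H[of 2 2] diag by auto
  moreover have "?w = column j (herm_action \<tau> A)"
    by (rule matrix_vector_mult_basis)
  ultimately show ?thesis
    by (metis column_def vec_lambda_beta)
qed

lemma herm_action_SL2_in_integer_points:
  assumes "A \<in> carrier (SL2 R)"
  shows "herm_action \<tau> A \<in> integer_points (orth_group (herm_form \<tau>))"
  using assms herm_action_integral herm_action_in_orth_group[OF Im_\<tau>_nonzero]
  by (simp add: integer_points_def carrier_SL2)

lemma subgroup_herm_action:
  "subgroup (herm_action \<tau> ` elementary_group R) (mat_group (integer_points (orth_group (herm_form \<tau>))))"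
    (is "subgroup ?\<Gamma> ?G")
proof -
  have carrier: "herm_action \<tau> A \<in> carrier ?G" if "A \<in> elementary_group R" for A
    using that elementary_group_subset_SL2 herm_action_SL2_in_integer_points
    by (auto simp: mat_group_def)
  have mult: "x \<otimes>\<^bsub>?G\<^esub> y = x ** y" and one: "\<one>\<^bsub>?G\<^esub> = mat 1" for x y
    by (simp_all add: mat_group_def)
  show ?thesis
  proof
    show "?\<Gamma> \<subseteq> carrier ?G" using carrier by blast
    show "x \<otimes>\<^bsub>?G\<^esub> y \<in> ?\<Gamma>" if "x \<in> ?\<Gamma>" "y \<in> ?\<Gamma>" for x y
      using that elementary_group_mult
      by (auto simp: mult herm_action_mult[OF Im_\<tau>_nonzero, symmetric])
    show "\<one>\<^bsub>?G\<^esub> \<in> ?\<Gamma>"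
      unfolding one using herm_action_one[OF Im_\<tau>_nonzero] elementary_group.one by (metis imageI)
    show "inv\<^bsub>?G\<^esub> x \<in> ?\<Gamma>" if x: "x \<in> ?\<Gamma>" for x
    proof -
      obtain A where A: "x = herm_action \<tau> A" "A \<in> elementary_group R"
        using x by blast
      let ?y = "herm_action \<tau> (mat2_inv A)"
      have inv: "x ** ?y = mat 1" "?y ** x = mat 1"
        using mat2_inv[OF det_elementary_group[OF A(2)]]
        by (simp_all add: A herm_action_mult[OF Im_\<tau>_nonzero, symmetric] herm_action_one[OF Im_\<tau>_nonzero])
      \<comment> \<open>The inverse is found from its description: a two-sided matrix inverse is
        unique, and this one is integral since it comes from the elementary group.\<close>
      have "inv\<^bsub>?G\<^esub> x = ?y"
        unfolding m_inv_def mult one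
      proof (rule the_equality)
        show "?y \<in> carrier ?G \<and> x ** ?y = mat 1 \<and> ?y ** x = mat 1"
          using inv carrier elementary_group_inv A by blast
        show "z = ?y" if "z \<in> carrier ?G \<and> x ** z = mat 1 \<and> z ** x = mat 1" for z
          using that inv by (metis matrix_mul_assoc matrix_mul_lid matrix_mul_rid)
      qed
      then show ?thesis using elementary_group_inv A by blast
    qed
  qed
qed

text \<open>The action on Hermitian matrices determines the image of infinity, so equal actions can
  be compared as Moebius maps without discussing the kernel.\<close>

lemma herm_action_eq_imp_reduced_orbit:
  assumes z: "far_from_ring (A $ 1 $ 1 / A $ 2 $ 1)" and nz: "A $ 2 $ 1 \<noteq> 0" "B $ 2 $ 1 \<noteq> 0"
    and g: "g \<in> elementary_group R" and eq: "herm_action \<tau> B = herm_action \<tau> g ** herm_action \<tau> A"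
  shows "B $ 1 $ 1 / B $ 2 $ 1 \<in> reduced_orbit (A $ 1 $ 1 / A $ 2 $ 1)"
proof -
  \<comment> \<open>This isotropic vector stands for diag(1, 0), the boundary point infinity. Its
    image under A is the first column of A times its conjugate transpose; the ratio of the entries
    (1,2) and (2,2) recovers \<open>A $ 1 $ 1 / A $ 2 $ 1\<close>.\<close>
  let ?C = "g ** A" and ?e = "axis 1 1 :: real ^ 4"
  have "herm \<tau> (herm_action \<tau> B *v ?e) = herm \<tau> (herm_action \<tau> ?C *v ?e)"
    by (simp add: eq herm_action_mult[OF Im_\<tau>_nonzero])
  then have H: "B ** herm \<tau> ?e ** conj_transpose B = ?C ** herm \<tau> ?e ** conj_transpose ?C"
    unfolding herm_herm_action[OF Im_\<tau>_nonzero] .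
  have 12: "B $ 1 $ 1 * cnj (B $ 2 $ 1) = ?C $ 1 $ 1 * cnj (?C $ 2 $ 1)"
    using arg_cong[OF H, of "\<lambda>M. M $ 1 $ 2"] by (simp add: axis_def)
  have 22: "B $ 2 $ 1 * cnj (B $ 2 $ 1) = ?C $ 2 $ 1 * cnj (?C $ 2 $ 1)"
    using arg_cong[OF H, of "\<lambda>M. M $ 2 $ 2"] by (simp add: axis_def)
  obtain d w where dw: "d \<noteq> 0" "w \<in> reduced_orbit (A $ 1 $ 1 / A $ 2 $ 1)"
    "?C $ 1 $ 1 = d * w" "?C $ 2 $ 1 = d"
  proof (rule elementary_group_reduced_orbit[OF z g nz(1)])
    fix d w
    assume "d \<noteq> 0" "w \<in> reduced_orbit (A $ 1 $ 1 / A $ 2 $ 1)"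
      "g $ 1 $ 1 * (A $ 2 $ 1 * (A $ 1 $ 1 / A $ 2 $ 1)) + g $ 1 $ 2 * A $ 2 $ 1 = d * w"
      "g $ 2 $ 1 * (A $ 2 $ 1 * (A $ 1 $ 1 / A $ 2 $ 1)) + g $ 2 $ 2 * A $ 2 $ 1 = d"
    then show thesis
      using nz(1) by (intro that[of d w]) simp_all
  qed
  have "B $ 1 $ 1 / B $ 2 $ 1 = (B $ 1 $ 1 * cnj (B $ 2 $ 1)) / (B $ 2 $ 1 * cnj (B $ 2 $ 1))"
    using nz by simp
  also have "\<dots> = w"
    unfolding 12 22 dw(3,4) using dw(1) by simp
  finally show ?thesis using dw(2) by simp
qed

text \<open>Matrices sending infinity to dyadic points of the square, with distinct denominators,
  represent distinct cosets: equal cosets would put two of these points in one orbit, and the square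
  meets each orbit at most once.\<close>

lemma infinite_rcosets:
  defines "\<Gamma> \<equiv> herm_action \<tau> ` elementary_group R"
  shows "infinite (rcosets\<^bsub>mat_group (integer_points (zariski_closure (orth_group (herm_form \<tau>)) \<Gamma>))\<^esub> \<Gamma>)"
    (is "infinite (rcosets\<^bsub>?G\<^esub> \<Gamma>)")
proof -
  obtain k\<^sub>0 where "\<And>k. k\<^sub>0 \<le> k \<Longrightarrow> \<exists>r\<in>R. (1 + 2 * r) / 2 ^ k \<in> hole"
    using eventually_dyadic_fraction_in_hole by blast
  then have "\<forall>j. \<exists>r. r \<in> R \<and> (1 + 2 * r) / 2 ^ (k\<^sub>0 + j) \<in> hole"
    by (metis le_add1)
  then obtain r where r: "\<And>j. r j \<in> R" "\<And>j. (1 + 2 * r j) / 2 ^ (k\<^sub>0 + j) \<in> hole"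
    by metis
  have "\<forall>j. \<exists>A. A \<in> carrier (SL2 R) \<and> A $ 1 $ 1 = 1 + 2 * r j \<and> A $ 2 $ 1 = 2 ^ (k\<^sub>0 + j)"
    using integral_matrix_with_first_column[OF r(1)] by metis
  then obtain A where A: "\<And>j. A j \<in> carrier (SL2 R)" "\<And>j. A j $ 1 $ 1 = 1 + 2 * r j"
    "\<And>j. A j $ 2 $ 1 = 2 ^ (k\<^sub>0 + j)"
    by metis
  let ?z = "\<lambda>j. (1 + 2 * r j) / 2 ^ (k\<^sub>0 + j)"
  have carrier: "herm_action \<tau> (A j) \<in> carrier ?G" for j
  proof -
    have "det (A j) = 1" "A j $ 2 $ 1 \<noteq> 0"
      using A by (simp_all add: carrier_SL2)
    \<comment> \<open>Membership in the Zariski closure: the middle factor is elementary over R, and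
      the outer factors may have any complex parameter.\<close>
    from upper_lower_upper_factorization[OF this] obtain u w
      where "A j = upper_elem u ** lower_elem (A j $ 2 $ 1) ** upper_elem w"
      by blast
    moreover have "lower_elem (A j $ 2 $ 1) \<in> elementary_group R"
      using A(1) by (intro lower_in_elementary_group) (simp add: carrier_SL2)
    ultimately have "herm_action \<tau> (A j) \<in> zariski_vanishing \<Gamma>"
      using zariski_vanishing_elementary_group[OF Im_\<tau>_nonzero R_memI] unfolding \<Gamma>_def by metis
    then show ?thesis
      using herm_action_SL2_in_integer_points[OF A(1)]
      by (simp add: mat_group_def integer_points_def zariski_closure_eq)
  qed
  have coset: "\<Gamma> #>\<^bsub>?G\<^esub> a = (\<lambda>h. h ** a) ` \<Gamma>" for a
    by (auto simp: r_coset_def mat_group_def)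
  have "inj (\<lambda>j. \<Gamma> #>\<^bsub>?G\<^esub> herm_action \<tau> (A j))"
  proof (rule injI)
    fix i j
    assume "\<Gamma> #>\<^bsub>?G\<^esub> herm_action \<tau> (A i) = \<Gamma> #>\<^bsub>?G\<^esub> herm_action \<tau> (A j)"
    moreover have "mat 1 \<in> \<Gamma>"
      unfolding \<Gamma>_def using herm_action_one[OF Im_\<tau>_nonzero] elementary_group.one by (metis imageI)
    then have "mat 1 ** herm_action \<tau> (A i) \<in> \<Gamma> #>\<^bsub>?G\<^esub> herm_action \<tau> (A i)"
      unfolding coset by (rule imageI)
    ultimately have "herm_action \<tau> (A i) \<in> (\<lambda>h. h ** herm_action \<tau> (A j)) ` \<Gamma>"
      by (simp add: coset)
    then obtain g where g: "g \<in> elementary_group R"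
      "herm_action \<tau> (A i) = herm_action \<tau> g ** herm_action \<tau> (A j)"
      unfolding \<Gamma>_def by blast
    have "A i $ 1 $ 1 / A i $ 2 $ 1 \<in> reduced_orbit (A j $ 1 $ 1 / A j $ 2 $ 1)"
      using g hole_far[OF r(2)] by (intro herm_action_eq_imp_reduced_orbit[of _ _ g]) (simp_all add: A)
    then have "?z i \<in> reduced_orbit (?z j)"
      by (simp add: A)
    then have "?z i - ?z j \<in> R"
      using reduced_orbit_far hole_far[OF r(2)] by blast
    then have "?z i = ?z j"
      using hole_diff_eq_0 r(2) by blast
    then have "k\<^sub>0 + i = k\<^sub>0 + j"
      by (rule dyadic_fractions_inj[OF r(1) r(1)])
    then show "i = j" by simp
  qed
  then have "infinite (range (\<lambda>j. \<Gamma> #>\<^bsub>?G\<^esub> herm_action \<tau> (A j)))"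
    by (rule range_inj_infinite)
  moreover have "range (\<lambda>j. \<Gamma> #>\<^bsub>?G\<^esub> herm_action \<tau> (A j)) \<subseteq> rcosets\<^bsub>?G\<^esub> \<Gamma>"
    using carrier unfolding RCOSETS_def by blast
  ultimately show ?thesis
    using finite_subset by blast
qed

lemma thin_E2: "thin_subgroup (orth_group (herm_form \<tau>)) (psl_action \<tau> ` E2 R)"
  unfolding thin_subgroup_def psl_action_E2
  using subgroup_herm_action infinite_rcosets by blast

end

subsection \<open>Integers of imaginary quadratic fields\<close>

lemma poly_map_of_int_add:
  "poly (map_poly of_int (p + q)) x = poly (map_poly of_int p) x + poly (map_poly of_int q) x"
  for x :: "'a::{comm_ring_1,ring_char_0}"
  by (induction p q rule: poly_induct2) (simp_all add: map_poly_pCons algebra_simps)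

lemma poly_map_of_int_smult:
  "poly (map_poly of_int (Polynomial.smult c p)) x = of_int c * poly (map_poly of_int p) x"
  for x :: "'a::{comm_ring_1,ring_char_0}"
  by (induction p) (simp_all add: map_poly_pCons algebra_simps)

lemma poly_map_of_int_mult:
  "poly (map_poly of_int (p * q)) x = poly (map_poly of_int p) x * poly (map_poly of_int q) x"
  for x :: "'a::{comm_ring_1,ring_char_0}"
  by (induction p)
    (simp_all add: mult_pCons_left map_poly_pCons poly_map_of_int_add poly_map_of_int_smult algebra_simps)

text \<open>Gauss's lemma: the primitive integral quadratic with root x divides a monic integral
  polynomial up to a constant, and comparing contents forces its leading coefficient to be a
  unit.\<close>

lemma quadratic_algebraic_int:
  fixes x :: complex
  assumes "algebraic_int x" "Im x \<noteq> 0" "2 * Re x \<in> \<rat>" "(norm x)\<^sup>2 \<in> \<rat>"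
  shows "2 * Re x \<in> \<int>" "(norm x)\<^sup>2 \<in> \<int>"
proof -
  obtain a\<^sub>1 d\<^sub>1 a\<^sub>2 d\<^sub>2 :: int where ad: "d\<^sub>1 > 0" "2 * Re x = of_int a\<^sub>1 / of_int d\<^sub>1"
    "d\<^sub>2 > 0" "(norm x)\<^sup>2 = of_int a\<^sub>2 / of_int d\<^sub>2"
    using assms(3,4) by (metis Rats_cases')
  have root: "x * x - of_real (2 * Re x) * x + of_real ((norm x)\<^sup>2) = 0"
    unfolding cmod_power2 by (simp add: complex_eq_iff power2_eq_square algebra_simps)
  \<comment> \<open>The polynomial with roots x and \<open>cnj x\<close>, cleared of denominators:
    its constant term is the norm and its linear coefficient minus the trace.\<close>
  define q\<^sub>0 where "q\<^sub>0 = [: a\<^sub>2 * d\<^sub>1, - (a\<^sub>1 * d\<^sub>2), d\<^sub>1 * d\<^sub>2 :]"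
  define g where "g = content q\<^sub>0"
  define q where "q = primitive_part q\<^sub>0"
  have q\<^sub>0: "q\<^sub>0 \<noteq> 0" "Polynomial.degree q\<^sub>0 = 2"
    using ad by (auto simp: q\<^sub>0_def)
  have q\<^sub>0_eq: "q\<^sub>0 = Polynomial.smult g q"
    unfolding g_def q_def by simp
  have g: "g \<noteq> 0" and q: "q \<noteq> 0" "Polynomial.degree q = 2" "content q = 1"
    using q\<^sub>0 by (auto simp: g_def q_def)
  define b a d where "b = Polynomial.coeff q 0" and "a = Polynomial.coeff q 1" and "d = Polynomial.coeff q 2"
  have coeffs: "a\<^sub>2 * d\<^sub>1 = g * b" "- (a\<^sub>1 * d\<^sub>2) = g * a" "d\<^sub>1 * d\<^sub>2 = g * d"
    using arg_cong[OF q\<^sub>0_eq, of "\<lambda>p. Polynomial.coeff p 0"] arg_cong[OF q\<^sub>0_eq, of "\<lambda>p. Polynomial.coeff p 1"]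
      arg_cong[OF q\<^sub>0_eq, of "\<lambda>p. Polynomial.coeff p 2"]
    by (simp_all add: q\<^sub>0_def a_def b_def d_def numeral_2_eq_2)
  have d: "d \<noteq> 0"
    using leading_coeff_neq_0[OF q(1)] q(2) by (simp add: d_def)
  have "2 * Re x = of_int (a\<^sub>1 * d\<^sub>2) / of_int (d\<^sub>1 * d\<^sub>2)" "(norm x)\<^sup>2 = of_int (a\<^sub>2 * d\<^sub>1) / of_int (d\<^sub>1 * d\<^sub>2)"
    using ad by simp_all
  moreover have "a\<^sub>1 * d\<^sub>2 = g * (- a)"
    using coeffs(2) by simp
  ultimately have tn: "2 * Re x = of_int (- a) / of_int d" "(norm x)\<^sup>2 = of_int b / of_int d"
    unfolding coeffs using g by simp_all
  have q_eq: "q = [:b, a, d:]"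
    by (rule poly_eqI) (use q in \<open>auto simp: a_def b_def d_def Polynomial.coeff_pCons numeral_2_eq_2
        coeff_eq_0 split: nat.splits\<close>)
  have q_root: "poly (map_poly of_int q) x = 0"
  proof -
    have "poly (map_poly of_int q) x = of_int b + of_int a * x + of_int d * (x * x)"
      by (simp add: q_eq map_poly_pCons algebra_simps)
    also have "\<dots> = of_int d * (x * x - of_real (2 * Re x) * x + of_real ((norm x)\<^sup>2))"
      unfolding tn using d by (simp add: field_simps)
    finally show ?thesis unfolding root by simp
  qed
  obtain f where f: "poly (map_poly of_int f) x = 0" "Polynomial.lead_coeff f = 1"
    using assms(1) unfolding algebraic_int_altdef_ipoly by blast
  obtain s r where sr: "pseudo_divmod f q = (s, r)"
    by (cases "pseudo_divmod f q")
  define c where "c = d ^ (Suc (Polynomial.degree f) - Polynomial.degree q)"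
  have c: "c \<noteq> 0" using d by (simp add: c_def)
  have div: "Polynomial.smult c f = q * s + r" "r = 0 \<or> Polynomial.degree r < 2"
    using pseudo_divmod[OF q(1) sr] q(2) by (simp_all add: c_def d_def)
  \<comment> \<open>The remainder has degree below 2 and integral coefficients, but x is not real,
    so it can only vanish at x by being zero.\<close>
  have "r = 0"
  proof -
    have "poly (map_poly complex_of_int r) x = 0"
      using arg_cong[OF div(1), of "\<lambda>p. poly (map_poly of_int p) x"] f(1) q_root
      by (simp add: poly_map_of_int_add poly_map_of_int_smult poly_map_of_int_mult)
    moreover have "r = [:Polynomial.coeff r 0, Polynomial.coeff r 1:]"
      by (rule poly_eqI) (use div(2) in \<open>auto simp: Polynomial.coeff_pCons coeff_eq_0 split: nat.splits\<close>)
    then obtain r\<^sub>0 r\<^sub>1 where r: "r = [:r\<^sub>0, r\<^sub>1:]" by blast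
    ultimately have "of_int r\<^sub>0 + x * of_int r\<^sub>1 = 0"
      by (simp add: map_poly_pCons)
    then have "r\<^sub>1 = 0 \<and> r\<^sub>0 = 0"
      using assms(2) by (auto simp: complex_eq_iff)
    then show ?thesis by (simp add: r)
  qed
  with div have fs: "Polynomial.smult c f = q * s" by simp
  have "content f dvd 1"
    using content_dvd_coeff[of f "Polynomial.degree f"] f(2) by simp
  then have "content f = 1"
    by (simp add: content_def)
  then have "content s = \<bar>c\<bar>"
    using arg_cong[OF fs, of content] q(3) by (simp add: content_mult)
  then have "c dvd Polynomial.lead_coeff s"
    using content_dvd_coeff[of s "Polynomial.degree s"] by simp
  then obtain m where m: "Polynomial.lead_coeff s = c * m"
    by (rule dvdE)
  have "c = d * (c * m)"
    using arg_cong[OF fs, of Polynomial.lead_coeff] f(2) c q(2)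
    by (simp add: lead_coeff_mult m d_def)
  then have "d * m = 1"
    using c by (simp add: mult.left_commute)
  then have "d = 1 \<or> d = -1"
    by (auto simp: zmult_eq_1_iff)
  then show "2 * Re x \<in> \<int>" "(norm x)\<^sup>2 \<in> \<int>"
    unfolding tn by auto
qed

lemma rational_sqrt_of_int:
  fixes c :: real
  assumes "c \<in> \<rat>" "c * c = of_int m"
  shows "c \<in> \<int>"
proof (rule rational_algebraic_int_is_int[OF _ assms(1)])
  show "algebraic_int c"
    by (rule algebraic_int.intros[of "[:- of_int m, 0, 1:]"])
      (auto simp: assms(2) Polynomial.coeff_pCons split: nat.splits)
qed

lemma four_Im_square: "4 * (Im x)\<^sup>2 = 4 * (norm x)\<^sup>2 - (2 * Re x) * (2 * Re x)"
  unfolding cmod_power2 by (simp add: power2_eq_square)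

section \<open>The ring of integers of an imaginary quadratic field\<close>

locale imag_quadratic =
  fixes K :: "complex set" and \<alpha> :: complex
  assumes K_eq: "K = {of_real r + of_real s * \<alpha> |r s. r \<in> \<rat> \<and> s \<in> \<rat>}"
    and Im_\<alpha>: "Im \<alpha> \<noteq> 0" and \<alpha>_square: "\<alpha> * \<alpha> \<in> K"
begin

abbreviation "\<O> \<equiv> ring_of_integers K"

lemma K_memI: "r \<in> \<rat> \<Longrightarrow> s \<in> \<rat> \<Longrightarrow> of_real r + of_real s * \<alpha> \<in> K"
  unfolding K_eq by blast

lemma rational_in_K: "r \<in> \<rat> \<Longrightarrow> of_real r \<in> K"
  using K_memI[of r 0] by simp

lemma \<alpha>_trace_norm: "2 * Re \<alpha> \<in> \<rat>" "(norm \<alpha>)\<^sup>2 \<in> \<rat>"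
proof -
  obtain r s where rs: "\<alpha> * \<alpha> = of_real r + of_real s * \<alpha>" "r \<in> \<rat>" "s \<in> \<rat>"
    using \<alpha>_square unfolding K_eq by blast
  have "2 * Re \<alpha> * Im \<alpha> = s * Im \<alpha>"
    using arg_cong[OF rs(1), of Im] by simp
  then have s: "2 * Re \<alpha> = s" using Im_\<alpha> by simp
  have "Re \<alpha> * Re \<alpha> - Im \<alpha> * Im \<alpha> = r + s * Re \<alpha>"
    using arg_cong[OF rs(1), of Re] by simp
  then have "(norm \<alpha>)\<^sup>2 = - r"
    unfolding cmod_power2 s[symmetric] by (simp add: power2_eq_square algebra_simps)
  with s rs show "2 * Re \<alpha> \<in> \<rat>" "(norm \<alpha>)\<^sup>2 \<in> \<rat>" by auto
qed

lemma K_trace: "x \<in> K \<Longrightarrow> 2 * Re x \<in> \<rat>"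
proof -
  assume "x \<in> K"
  then obtain r s where rs: "x = of_real r + of_real s * \<alpha>" "r \<in> \<rat>" "s \<in> \<rat>"
    unfolding K_eq by blast
  then have "2 * Re x = 2 * r + s * (2 * Re \<alpha>)" by simp
  also have "\<dots> \<in> \<rat>"
    by (intro Rats_add Rats_mult Rats_number_of rs \<alpha>_trace_norm)
  finally show ?thesis .
qed

lemma K_norm: "x \<in> K \<Longrightarrow> (norm x)\<^sup>2 \<in> \<rat>"
proof -
  assume "x \<in> K"
  then obtain r s where rs: "x = of_real r + of_real s * \<alpha>" "r \<in> \<rat>" "s \<in> \<rat>"
    unfolding K_eq by blast
  then have "(norm x)\<^sup>2 = r * r + r * s * (2 * Re \<alpha>) + s * s * (norm \<alpha>)\<^sup>2"
    unfolding cmod_power2 by (simp add: power2_eq_square algebra_simps)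
  also have "\<dots> \<in> \<rat>"
    by (intro Rats_add Rats_mult rs \<alpha>_trace_norm)
  finally show ?thesis .
qed

lemma K_add: "x \<in> K \<Longrightarrow> y \<in> K \<Longrightarrow> x + y \<in> K"
proof -
  assume "x \<in> K" "y \<in> K"
  then obtain r s r' s' where "x = of_real r + of_real s * \<alpha>" "r \<in> \<rat>" "s \<in> \<rat>"
    "y = of_real r' + of_real s' * \<alpha>" "r' \<in> \<rat>" "s' \<in> \<rat>"
    unfolding K_eq by blast
  then show ?thesis
    using K_memI[of "r + r'" "s + s'"] by (simp add: algebra_simps)
qed

lemma K_scale: "q \<in> \<rat> \<Longrightarrow> x \<in> K \<Longrightarrow> of_real q * x \<in> K"
proof -
  assume "q \<in> \<rat>" "x \<in> K"
  then obtain r s where "x = of_real r + of_real s * \<alpha>" "r \<in> \<rat>" "s \<in> \<rat>"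
    unfolding K_eq by blast
  then show ?thesis
    using K_memI[of "q * r" "q * s"] \<open>q \<in> \<rat>\<close> by (simp add: algebra_simps)
qed

lemma K_mult: "x \<in> K \<Longrightarrow> y \<in> K \<Longrightarrow> x * y \<in> K"
proof -
  assume x: "x \<in> K" and "y \<in> K"
  then obtain r s where y: "y = of_real r + of_real s * \<alpha>" "r \<in> \<rat>" "s \<in> \<rat>"
    unfolding K_eq by blast
  obtain r' s' where x': "x = of_real r' + of_real s' * \<alpha>" "r' \<in> \<rat>" "s' \<in> \<rat>"
    using x unfolding K_eq by blast
  have "x * \<alpha> = of_real r' * \<alpha> + of_real s' * (\<alpha> * \<alpha>)"
    by (simp add: x' algebra_simps)
  also have "\<dots> \<in> K"
    using x' K_memI[of 0 1] \<alpha>_square by (intro K_add K_scale) auto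
  finally have "of_real r * x + of_real s * (x * \<alpha>) \<in> K"
    using x y by (intro K_add K_scale)
  then show ?thesis by (simp add: y algebra_simps)
qed

lemma K_real:
  assumes "x \<in> K" "Im x = 0"
  shows "x \<in> \<rat>"
proof -
  obtain r s where rs: "x = of_real r + of_real s * \<alpha>" "r \<in> \<rat>"
    using assms(1) unfolding K_eq by blast
  then have "x = of_real r"
    using Im_\<alpha> assms(2) by simp
  moreover obtain a b where "r = of_int a / of_int b"
    using rs(2) by (metis Rats_cases')
  ultimately show ?thesis by simp
qed

text \<open>Both imaginary parts are rational multiples of Im \<alpha>, and the square of Im
  \<alpha> is rational, being the norm minus a quarter of the squared trace.\<close>

lemma K_Im_mult:
  assumes "x \<in> K" "y \<in> K"
  shows "Im x * Im y \<in> \<rat>"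
proof -
  obtain r s where x: "x = of_real r + of_real s * \<alpha>" "r \<in> \<rat>" "s \<in> \<rat>"
    using assms(1) unfolding K_eq by blast
  obtain r' s' where y: "y = of_real r' + of_real s' * \<alpha>" "r' \<in> \<rat>" "s' \<in> \<rat>"
    using assms(2) unfolding K_eq by blast
  have "Im x * Im y = s * s' * ((norm \<alpha>)\<^sup>2 - (2 * Re \<alpha>) * (2 * Re \<alpha>) / 4)"
    unfolding cmod_power2 by (simp add: x y power2_eq_square algebra_simps)
  also have "\<dots> \<in> \<rat>"
    by (intro Rats_mult Rats_diff Rats_divide Rats_number_of x y \<alpha>_trace_norm)
  finally show ?thesis .
qed

text \<open>Integrality is read off trace and norm, from which the ring properties are then derived.
  Rational elements are treated apart, as their minimal polynomial is linear.\<close>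

lemma ring_of_integers_iff: "x \<in> \<O> \<longleftrightarrow> x \<in> K \<and> 2 * Re x \<in> \<int> \<and> (norm x)\<^sup>2 \<in> \<int>"
proof
  assume x: "x \<in> \<O>"
  then have K: "x \<in> K" and int: "algebraic_int x" by (auto simp: ring_of_integers_def)
  show "x \<in> K \<and> 2 * Re x \<in> \<int> \<and> (norm x)\<^sup>2 \<in> \<int>"
  proof (cases "Im x = 0")
    case True
    then obtain m where "x = of_int m"
      using rational_algebraic_int_is_int[OF int K_real[OF K]] by (auto elim: Ints_cases)
    then show ?thesis using K by auto
  next
    case False
    then show ?thesis using quadratic_algebraic_int int K K_trace K_norm by blast
  qed
next
  assume x: "x \<in> K \<and> 2 * Re x \<in> \<int> \<and> (norm x)\<^sup>2 \<in> \<int>"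
  then obtain a b where ab: "2 * Re x = of_int a" "(norm x)\<^sup>2 = of_int b"
    by (metis Ints_cases)
  have "algebraic_int x"
  proof (rule algebraic_int.intros[of "[:of_int b, - of_int a, 1:]"])
    have "x * x - of_real (2 * Re x) * x + of_real ((norm x)\<^sup>2) = 0"
      unfolding cmod_power2 by (simp add: complex_eq_iff power2_eq_square algebra_simps)
    then show "poly [:of_int b, - of_int a, 1:] x = 0"
      unfolding ab by (simp add: algebra_simps)
  qed (auto simp: Polynomial.coeff_pCons split: nat.splits)
  with x show "x \<in> \<O>" by (simp add: ring_of_integers_def)
qed

lemma of_int_in_integers: "of_int m \<in> \<O>"
  using rational_in_K[of "of_int m"] by (simp add: ring_of_integers_iff)

text \<open>The squares of the integers \<open>4 Im x Im y\<close> and \<open>(2 Re x) (2 Re y)\<close> are congruent modulo 4, so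
  the integers have the same parity.\<close>

lemma integers_inner:
  assumes "x \<in> \<O>" "y \<in> \<O>"
  shows "2 * (Re x * Re y + Im x * Im y) \<in> \<int>"
proof -
  have K: "x \<in> K" "y \<in> K" using assms by (auto simp: ring_of_integers_iff)
  obtain a n where x: "2 * Re x = of_int a" "(norm x)\<^sup>2 = of_int n"
    using assms(1) by (metis ring_of_integers_iff Ints_cases)
  obtain b m where y: "2 * Re y = of_int b" "(norm y)\<^sup>2 = of_int m"
    using assms(2) by (metis ring_of_integers_iff Ints_cases)
  have A: "4 * (Im x)\<^sup>2 = of_int (4 * n - a * a)"
    unfolding four_Im_square x by simp
  have B: "4 * (Im y)\<^sup>2 = of_int (4 * m - b * b)"
    unfolding four_Im_square y by simp
  let ?c = "4 * (Im x * Im y)"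
  have "?c * ?c = (4 * (Im x)\<^sup>2) * (4 * (Im y)\<^sup>2)"
    by (simp add: power2_eq_square)
  also have "\<dots> = of_int ((4 * n - a * a) * (4 * m - b * b))"
    unfolding A B by simp
  finally have cc: "?c * ?c = of_int ((4 * n - a * a) * (4 * m - b * b))" .
  have "?c \<in> \<rat>"
    using K_Im_mult[OF K] by auto
  then obtain c where c: "?c = of_int c"
    using rational_sqrt_of_int cc by (metis Ints_cases)
  have "real_of_int (c * c) = of_int ((4 * n - a * a) * (4 * m - b * b))"
    using cc unfolding c by simp
  then have "c * c = (4 * n - a * a) * (4 * m - b * b)"
    by (simp only: of_int_eq_iff)
  then have "even (c * c) = even ((4 * n - a * a) * (4 * m - b * b))" by simp
  then have "even (a * b + c)" by auto
  then obtain k where k: "a * b + c = 2 * k" by blast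
  have "2 * (2 * (Re x * Re y + Im x * Im y)) = (2 * Re x) * (2 * Re y) + ?c"
    by (simp add: algebra_simps)
  also have "\<dots> = of_int (a * b + c)"
    unfolding c x y by simp
  also have "\<dots> = 2 * of_int k"
    unfolding k by simp
  finally have "2 * (Re x * Re y + Im x * Im y) = of_int k" by simp
  then show ?thesis by (metis Ints_of_int)
qed

text \<open>By polarization the norm of a sum differs from the sum of the norms by twice the inner
  product.\<close>

lemma integers_add:
  assumes "x \<in> \<O>" "y \<in> \<O>"
  shows "x + y \<in> \<O>"
proof -
  have "(norm (x + y))\<^sup>2 = (norm x)\<^sup>2 + (norm y)\<^sup>2 + 2 * (Re x * Re y + Im x * Im y)"
    unfolding cmod_power2 by (simp add: power2_eq_square algebra_simps)
  then show ?thesis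
    using assms integers_inner[OF assms] K_add
    by (auto simp: ring_of_integers_iff distrib_left)
qed

lemma integers_cnj:
  assumes "x \<in> \<O>"
  shows "cnj x \<in> \<O>"
proof -
  have "cnj x = of_real (2 * Re x) + of_real (-1) * x"
    by (simp add: complex_eq_iff)
  also have "\<dots> \<in> K"
    using assms by (intro K_add K_scale rational_in_K) (auto simp: ring_of_integers_iff K_trace)
  finally show ?thesis
    using assms by (simp add: ring_of_integers_iff)
qed

text \<open>The trace of \<open>x * y\<close> is twice the inner product of x and
  \<open>cnj y\<close>.\<close>

lemma integers_mult:
  assumes "x \<in> \<O>" "y \<in> \<O>"
  shows "x * y \<in> \<O>"
proof -
  have "2 * Re (x * y) = 2 * (Re x * Re (cnj y) + Im x * Im (cnj y))"
    by simp
  also have "\<dots> \<in> \<int>"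
    by (intro integers_inner assms integers_cnj)
  finally show ?thesis
    using assms K_mult by (auto simp: ring_of_integers_iff norm_mult power_mult_distrib)
qed

lemma integers_uminus: "x \<in> \<O> \<Longrightarrow> - x \<in> \<O>"
  using integers_mult[OF of_int_in_integers[of "-1"]] by simp

lemma integers_real:
  assumes "x \<in> \<O>" "Im x = 0"
  obtains m where "x = of_int m"
  using rational_algebraic_int_is_int[of x] K_real assms
  by (auto simp: ring_of_integers_def elim: Ints_cases)

text \<open>Multiply \<alpha> by a common denominator of its trace and norm, and change the sign if
  necessary.\<close>

lemma exists_nonreal_integer: "\<exists>x\<in>\<O>. 0 < Im x"
proof -
  obtain a\<^sub>1 d\<^sub>1 a\<^sub>2 d\<^sub>2 :: int where ad: "d\<^sub>1 > 0" "2 * Re \<alpha> = of_int a\<^sub>1 / of_int d\<^sub>1"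
    "d\<^sub>2 > 0" "(norm \<alpha>)\<^sup>2 = of_int a\<^sub>2 / of_int d\<^sub>2"
    using \<alpha>_trace_norm by (metis Rats_cases')
  define x where "x = of_int (d\<^sub>1 * d\<^sub>2) * \<alpha>"
  have "x \<in> K"
    using K_scale[of "of_int (d\<^sub>1 * d\<^sub>2)" \<alpha>] K_memI[of 0 1] by (simp add: x_def)
  moreover have "2 * Re x = of_int (d\<^sub>1 * d\<^sub>2) * (2 * Re \<alpha>)"
    by (simp add: x_def)
  then have "2 * Re x = of_int (d\<^sub>2 * a\<^sub>1)"
    unfolding ad using ad by simp
  then have "2 * Re x \<in> \<int>" by simp
  moreover have "(norm x)\<^sup>2 = of_int ((d\<^sub>1 * d\<^sub>2)\<^sup>2) * (norm \<alpha>)\<^sup>2"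
    by (simp add: x_def norm_mult power_mult_distrib)
  then have "(norm x)\<^sup>2 = of_int (d\<^sub>1\<^sup>2 * d\<^sub>2 * a\<^sub>2)"
    unfolding ad using ad by (simp add: power2_eq_square)
  then have "(norm x)\<^sup>2 \<in> \<int>" by simp
  ultimately have x: "x \<in> \<O>" by (simp add: ring_of_integers_iff)
  have "Im x \<noteq> 0"
    using Im_\<alpha> ad by (simp add: x_def)
  then have "0 < Im x \<or> 0 < Im (- x)" by auto
  then show ?thesis using x integers_uminus by blast
qed

lemma integers_Im_square:
  assumes "x \<in> \<O>"
  obtains k :: int where "4 * (Im x)\<^sup>2 = of_int k"
proof -
  obtain a n where "2 * Re x = of_int a" "(norm x)\<^sup>2 = of_int n"
    using assms by (metis ring_of_integers_iff Ints_cases)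
  then have "4 * (Im x)\<^sup>2 = of_int (4 * n - a * a)"
    unfolding four_Im_square by simp
  then show ?thesis by (rule that)
qed

end

lemma int_square_mod_4: "(t::int) * t mod 4 = (if even t then 0 else 1)"
proof (cases "even t")
  case True
  then obtain e where "t = 2 * e" by blast
  then have "t * t = 4 * (e * e)" by simp
  then show ?thesis using True by simp
next
  case False
  then obtain e where "t = 2 * e + 1" by (rule oddE)
  then have "t * t = 4 * (e * e + e) + 1" by (simp add: algebra_simps)
  then show ?thesis using False by (simp only: if_False) presburger
qed

text \<open>The expression u \<open>cnj v\<close> - v \<open>cnj u\<close> is alternating and
  bilinear over the integers, so a change of basis multiplies it by the determinant.\<close>

lemma basis_change_disc:
  fixes u v :: complex and a b c d :: int
  shows "(of_int a * u + of_int b * v) * cnj (of_int c * u + of_int d * v) -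
    (of_int c * u + of_int d * v) * cnj (of_int a * u + of_int b * v) =
    of_int (a * d - b * c) * (u * cnj v - v * cnj u)"
  by (simp add: algebra_simps)

section \<open>Integral bases and the discriminant\<close>

context imag_quadratic
begin

lemma integers_diff: "x \<in> \<O> \<Longrightarrow> y \<in> \<O> \<Longrightarrow> x - y \<in> \<O>"
  using integers_add[of x "- y"] integers_uminus by simp

text \<open>Take \<omega> of least positive imaginary part. Division with remainder on imaginary
  parts makes every integer real after subtracting a multiple of \<omega>, and real integers of K
  are rational integers.\<close>

lemma exists_integral_basis:
  obtains \<omega> where "\<omega> \<in> \<O>" "0 < Im \<omega>" "\<O> = {of_int m + of_int n * \<omega> |m n. True}"
proof -
  \<comment> \<open>On integers of K the value 4 (Im x)^2 is itself an integer, so rounding loses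
    nothing and a minimum over the natural numbers exists.\<close>
  define f where "f x = nat \<lfloor>4 * (Im x)\<^sup>2\<rfloor>" for x
  obtain \<omega> where \<omega>: "\<omega> \<in> \<O>" "0 < Im \<omega>" and least: "\<And>y. y \<in> \<O> \<Longrightarrow> 0 < Im y \<Longrightarrow> f \<omega> \<le> f y"
    using exists_nonreal_integer ex_has_least_nat[of "\<lambda>x. x \<in> \<O> \<and> 0 < Im x" _ f] by blast
  have "x \<in> {of_int m + of_int n * \<omega> |m n. True}" if x: "x \<in> \<O>" for x
  proof -
    define n where "n = \<lfloor>Im x / Im \<omega>\<rfloor>"
    define y where "y = x - of_int n * \<omega>"
    have y: "y \<in> \<O>"
      unfolding y_def by (intro integers_diff integers_mult of_int_in_integers x \<omega>)
    have "of_int n \<le> Im x / Im \<omega>" "Im x / Im \<omega> < of_int n + 1"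
      unfolding n_def by linarith+
    then have Im_y: "0 \<le> Im y" "Im y < Im \<omega>"
      using \<omega>(2) by (simp_all add: y_def field_simps)
    have "Im y = 0"
    proof (rule ccontr)
      assume "Im y \<noteq> 0"
      then have pos: "0 < Im y" using Im_y by simp
      obtain k l :: int where kl: "4 * (Im y)\<^sup>2 = of_int k" "4 * (Im \<omega>)\<^sup>2 = of_int l"
        using integers_Im_square y \<omega>(1) by metis
      have "(Im y)\<^sup>2 < (Im \<omega>)\<^sup>2"
        using Im_y by (intro power_strict_mono) auto
      then have "4 * (Im y)\<^sup>2 < 4 * (Im \<omega>)\<^sup>2" by simp
      then have "k < l" "0 \<le> real_of_int k"
        unfolding kl using kl(1) by simp_all (metis kl(1) zero_le_power2 mult_nonneg_nonneg zero_le_numeral of_int_0_le_iff)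
      then have "f y < f \<omega>"
        unfolding f_def kl by simp
      then show False
        using least[OF y pos] by simp
    qed
    then obtain m where "y = of_int m"
      using y integers_real by blast
    then have "x = of_int m + of_int n * \<omega>"
      by (simp add: y_def algebra_simps)
    then show ?thesis by blast
  qed
  moreover have "of_int m + of_int n * \<omega> \<in> \<O>" for m n
    by (intro integers_add integers_mult of_int_in_integers \<omega>)
  ultimately have "\<O> = {of_int m + of_int n * \<omega> |m n. True}" by blast
  then show ?thesis using that \<omega> by blast
qed

text \<open>Shows that the definite description in \<open>field_disc\<close> is well-defined: two
  integral bases differ by integral matrices whose determinants multiply to 1, and squaring removes
  the sign.\<close>

lemma field_disc_eq:
  assumes \<omega>: "0 < Im \<omega>" and O: "\<O> = {of_int m + of_int n * \<omega> |m n. True}"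
    and D: "of_int D = - 4 * (Im \<omega>)\<^sup>2"
  shows "field_disc K = D"
proof -
  have disc: "(1 * cnj \<omega> - \<omega> * cnj 1)\<^sup>2 = complex_of_int D"
  proof -
    have "(1 * cnj \<omega> - \<omega> * cnj 1)\<^sup>2 = of_real (- 4 * (Im \<omega>)\<^sup>2)"
      by (simp add: complex_eq_iff power2_eq_square)
    then show ?thesis unfolding D[symmetric] by simp
  qed
  have basis: "integral_basis K 1 \<omega>"
    unfolding integral_basis_def bij_betw_def
  proof
    show "inj (\<lambda>(a, b). complex_of_int a * 1 + complex_of_int b * \<omega>)"
      using \<omega> by (auto simp: inj_on_def complex_eq_iff)
    show "range (\<lambda>(a, b). complex_of_int a * 1 + complex_of_int b * \<omega>) = \<O>"
      unfolding O by auto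
  qed
  have unique: "(w\<^sub>1 * cnj w\<^sub>2 - w\<^sub>2 * cnj w\<^sub>1)\<^sup>2 = complex_of_int D" if "integral_basis K w\<^sub>1 w\<^sub>2" for w\<^sub>1 w\<^sub>2
  proof -
    have range: "range (\<lambda>(a, b). complex_of_int a * w\<^sub>1 + complex_of_int b * w\<^sub>2) = \<O>"
      using that unfolding integral_basis_def by (rule bij_betw_imp_surj_on)
    have "of_int a * w\<^sub>1 + of_int b * w\<^sub>2 \<in> \<O>" for a b
      unfolding range[symmetric] by (rule image_eqI[of _ _ "(a, b)"]) simp_all
    from this[of 1 0] this[of 0 1] have "w\<^sub>1 \<in> \<O>" "w\<^sub>2 \<in> \<O>"
      by simp_all
    then obtain a b c d where w: "w\<^sub>1 = of_int a * 1 + of_int b * \<omega>" "w\<^sub>2 = of_int c * 1 + of_int d * \<omega>"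
      unfolding O by auto
    have "1 \<in> \<O>" "\<omega> \<in> \<O>"
      using of_int_in_integers[of 1] O by (auto intro: exI[of _ "0::int"] exI[of _ "1::int"])
    then obtain a' b' c' d' where w': "1 = of_int a' * w\<^sub>1 + of_int b' * w\<^sub>2" "\<omega> = of_int c' * w\<^sub>1 + of_int d' * w\<^sub>2"
      unfolding range[symmetric] by auto
    define e e' where "e = a * d - b * c" and "e' = a' * d' - b' * c'"
    let ?\<delta> = "1 * cnj \<omega> - \<omega> * cnj 1" and ?\<delta>' = "w\<^sub>1 * cnj w\<^sub>2 - w\<^sub>2 * cnj w\<^sub>1"
    have \<delta>': "?\<delta>' = of_int e * ?\<delta>"
      unfolding w e_def by (rule basis_change_disc)
    have \<delta>: "?\<delta> = of_int e' * ?\<delta>'"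
      using basis_change_disc[of a' w\<^sub>1 b' w\<^sub>2 c' d'] unfolding w'[symmetric] e'_def .
    have "?\<delta> \<noteq> 0"
      using \<omega> by (auto simp: complex_eq_iff)
    moreover have "?\<delta> = of_int (e' * e) * ?\<delta>"
      using \<delta> unfolding \<delta>' by simp
    ultimately have "complex_of_int (e' * e) = of_int 1"
      using mult_cancel_right1[of ?\<delta> "of_int (e' * e)"] unfolding of_int_1 by blast
    then have "e' * e = 1"
      by (simp only: of_int_eq_iff)
    then have "e = 1 \<or> e = -1"
      by (auto simp: zmult_eq_1_iff)
    then have "(complex_of_int e)\<^sup>2 = 1" by auto
    then show ?thesis
      unfolding \<delta>' disc[symmetric] power_mult_distrib by (simp only: mult_1)
  qed
  show ?thesis
    unfolding field_disc_def
  proof (rule the_equality)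
    show "\<exists>\<omega>\<^sub>1 \<omega>\<^sub>2. integral_basis K \<omega>\<^sub>1 \<omega>\<^sub>2 \<and> of_int D = (\<omega>\<^sub>1 * cnj \<omega>\<^sub>2 - \<omega>\<^sub>2 * cnj \<omega>\<^sub>1)\<^sup>2"
      using basis disc by metis
    show "E = D" if "\<exists>\<omega>\<^sub>1 \<omega>\<^sub>2. integral_basis K \<omega>\<^sub>1 \<omega>\<^sub>2 \<and> of_int E = (\<omega>\<^sub>1 * cnj \<omega>\<^sub>2 - \<omega>\<^sub>2 * cnj \<omega>\<^sub>1)\<^sup>2" for E
      using that unique by (metis of_int_eq_iff)
  qed
qed

section \<open>Euclidean division and the bound on the discriminant\<close>

lemma subring_integers: "subring \<O> complex_ring"
proof -
  interpret C: field "complex_ring" by (rule field_from_type_algebra)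
  have uminus: "\<ominus>\<^bsub>complex_ring\<^esub> x = - x" for x
    by (rule C.minus_equality) (auto simp: ring_of_type_algebra_def)
  show ?thesis
  proof (rule C.subringI)
    show "\<ominus>\<^bsub>complex_ring\<^esub> x \<in> \<O>" if "x \<in> \<O>" for x
      unfolding uminus using that by (rule integers_uminus)
  qed (use of_int_in_integers[of 1] in \<open>auto simp: ring_of_type_algebra_def intro: integers_add integers_mult\<close>)
qed

text \<open>Rounding first the imaginary and then the real part puts every complex number at squared
  distance less than 3/4 + 1/4 from an integer of K. The norm then serves as Euclidean
  function.\<close>

lemma euclidean_integers_if_Im_small:
  assumes \<omega>: "\<omega> \<in> \<O>" "0 < Im \<omega>" "(Im \<omega>)\<^sup>2 < 3"
  shows "euclidean_integers K"
proof -
  define \<phi> where "\<phi> x = nat \<lfloor>(norm x)\<^sup>2\<rfloor>" for x :: complex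
  let ?R = "complex_ring\<lparr>carrier := \<O>\<rparr>"
  interpret C: field "complex_ring" by (rule field_from_type_algebra)
  interpret D: domain ?R
    by (rule C.subring_is_domain[OF subring_integers])
  have near: "\<exists>q\<in>\<O>. norm (z - q) < 1" for z
  proof -
    define n where "n = round (Im z / Im \<omega>)"
    define w where "w = z - of_int n * \<omega>"
    define m where "m = round (Re w)"
    have "\<bar>Im z / Im \<omega> - of_int n\<bar> \<le> 1/2"
      unfolding n_def using of_int_round_abs_le by (metis abs_minus_commute)
    then have "\<bar>Im z / Im \<omega> - of_int n\<bar> * Im \<omega> \<le> 1/2 * Im \<omega>"
      using \<omega>(2) by (intro mult_right_mono) auto
    also have "\<bar>Im z / Im \<omega> - of_int n\<bar> * Im \<omega> = \<bar>(Im z / Im \<omega> - of_int n) * Im \<omega>\<bar>"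
      using \<omega>(2) by (simp add: abs_mult)
    also have "(Im z / Im \<omega> - of_int n) * Im \<omega> = Im w"
      using \<omega>(2) by (simp add: w_def field_simps)
    finally have "\<bar>Im w\<bar>\<^sup>2 \<le> (1/2 * Im \<omega>)\<^sup>2"
      by (intro power_mono) auto
    then have Im_w: "(Im w)\<^sup>2 < 3/4"
      using \<omega>(3) by (simp add: power2_eq_square)
    have "\<bar>Re w - of_int m\<bar> \<le> 1/2"
      unfolding m_def using of_int_round_abs_le by (metis abs_minus_commute)
    then have "\<bar>Re w - of_int m\<bar>\<^sup>2 \<le> (1/2)\<^sup>2"
      by (intro power_mono) auto
    then have Re_w: "(Re w - of_int m)\<^sup>2 \<le> 1/4"
      by (simp add: power2_eq_square)
    have "(norm (z - (of_int m + of_int n * \<omega>)))\<^sup>2 = (norm (w - of_int m))\<^sup>2"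
      by (simp add: w_def algebra_simps)
    also have "\<dots> = (Re w - of_int m)\<^sup>2 + (Im w)\<^sup>2"
      by (simp add: cmod_power2)
    also have "\<dots> < 1\<^sup>2"
      using Im_w Re_w by simp
    finally have "norm (z - (of_int m + of_int n * \<omega>)) < 1"
      by (rule power2_less_imp_less) simp
    moreover have "of_int m + of_int n * \<omega> \<in> \<O>"
      by (intro integers_add integers_mult of_int_in_integers \<omega>)
    ultimately show ?thesis by blast
  qed
  have "euclidean_domain ?R \<phi>"
  proof (rule D.euclidean_domainI)
    fix a b assume "a \<in> carrier ?R - {\<zero>\<^bsub>?R\<^esub>}" "b \<in> carrier ?R - {\<zero>\<^bsub>?R\<^esub>}"
    then have ab: "a \<in> \<O>" "b \<in> \<O>" "b \<noteq> 0"
      by (auto simp: ring_of_type_algebra_def)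
    obtain q where q: "q \<in> \<O>" "norm (a / b - q) < 1"
      using near by blast
    define r where "r = a - b * q"
    have r: "r \<in> \<O>"
      unfolding r_def by (intro integers_diff integers_mult ab q)
    have "norm r = norm (a / b - q) * norm b"
      unfolding norm_mult[symmetric] using ab(3) by (simp add: r_def algebra_simps)
    also have "\<dots> < norm b"
      using q(2) ab(3) by simp
    finally have less: "(norm r)\<^sup>2 < (norm b)\<^sup>2"
      by (intro power_strict_mono) auto
    obtain k l :: int where kl: "(norm r)\<^sup>2 = of_int k" "(norm b)\<^sup>2 = of_int l"
      using r ab(2) by (metis ring_of_integers_iff Ints_cases)
    have "0 \<le> real_of_int k" unfolding kl(1)[symmetric] by simp
    then have "\<phi> r < \<phi> b"
      using less unfolding \<phi>_def kl by simp
    moreover have "a = b * q + r" by (simp add: r_def)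
    ultimately show "\<exists>q r. q \<in> carrier ?R \<and> r \<in> carrier ?R \<and> a = b \<otimes>\<^bsub>?R\<^esub> q \<oplus>\<^bsub>?R\<^esub> r \<and>
        (r = \<zero>\<^bsub>?R\<^esub> \<or> \<phi> r < \<phi> b)"
      using q r by (intro exI[of _ q] exI[of _ r]) (simp add: ring_of_type_algebra_def)
  qed
  then show ?thesis
    unfolding euclidean_integers_def by blast
qed

text \<open>Excludes discriminant - 12, the boundary case of the previous estimate: then
  \<open>\<O>\<close> would miss an integer at half the height of \<omega>.\<close>

lemma Im_square_neq_3:
  assumes \<omega>: "\<omega> \<in> \<O>" "0 < Im \<omega>" and O: "\<O> = {of_int m + of_int n * \<omega> |m n. True}"
  shows "(Im \<omega>)\<^sup>2 \<noteq> 3"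
proof
  assume 3: "(Im \<omega>)\<^sup>2 = 3"
  obtain t N where tN: "2 * Re \<omega> = of_int t" "(norm \<omega>)\<^sup>2 = of_int N"
    using \<omega>(1) by (metis ring_of_integers_iff Ints_cases)
  have "real_of_int 12 = of_int (4 * N - t * t)"
    using four_Im_square[of \<omega>] unfolding tN 3 by simp
  then have "12 = 4 * N - t * t"
    by (simp only: of_int_eq_iff)
  then have "t * t mod 4 = 0" by presburger
  then have "even t" by (simp add: int_square_mod_4 split: if_splits)
  then obtain e where e: "t = 2 * e" by blast
  then have Re: "Re \<omega> = of_int e" using tN by simp
  \<comment> \<open>The sixth root of unity with real part 1/2 and imaginary part half that of
    \<omega>; its trace and norm are both 1.\<close>
  define x where "x = of_real (1/2) * (of_int (1 - e) + \<omega>)"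
  have "x \<in> K"
    unfolding x_def using of_int_in_integers \<omega>(1)
    by (intro K_scale K_add) (auto simp: ring_of_integers_iff simp del: of_int_diff)
  moreover have "2 * Re x = 1"
    by (simp add: x_def Re)
  moreover have "(norm x)\<^sup>2 = 1"
    unfolding cmod_power2 using 3 by (simp add: x_def Re power2_eq_square)
  ultimately have "x \<in> \<O>"
    by (simp add: ring_of_integers_iff)
  then obtain m n where "x = of_int m + of_int n * \<omega>"
    unfolding O by blast
  then have "Im x = of_int n * Im \<omega>" by simp
  moreover have "Im x = 1/2 * Im \<omega>" by (simp add: x_def)
  ultimately have "real_of_int (2 * n) = of_int 1"
    using \<omega>(2) by simp
  then have "2 * n = 1" by (simp only: of_int_eq_iff)
  then show False by presburger
qed

text \<open>Identifies \<tau> with \<omega> up to sign and an integral translation, so that 1 and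
  \<tau> form an integral basis whichever root of its equation \<tau> is.\<close>

lemma imaginary_quadratic_order_integers:
  assumes "\<Delta> = field_disc K"
    and even: "\<Delta> mod 4 = 0 \<Longrightarrow> \<tau>\<^sup>2 = of_int \<Delta> / 4"
    and odd: "\<Delta> mod 4 = 1 \<Longrightarrow> \<tau>\<^sup>2 = \<tau> + (of_int \<Delta> - 1) / 4"
    and "\<not> euclidean_integers K"
  obtains t N where "imaginary_quadratic_order \<O> \<tau> t N"
proof -
  obtain \<omega> where \<omega>: "\<omega> \<in> \<O>" "0 < Im \<omega>" and O: "\<O> = {of_int m + of_int n * \<omega> |m n. True}"
    by (rule exists_integral_basis)
  obtain t N where tN: "2 * Re \<omega> = of_int t" "(norm \<omega>)\<^sup>2 = of_int N"
    using \<omega>(1) by (metis ring_of_integers_iff Ints_cases)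
  have "4 * (Im \<omega>)\<^sup>2 = of_int (4 * N - t * t)"
    unfolding four_Im_square tN by simp
  then have D: "of_int (t * t - 4 * N) = - 4 * (Im \<omega>)\<^sup>2" by simp
  then have \<Delta>: "\<Delta> = t * t - 4 * N"
    unfolding assms(1) by (rule field_disc_eq[OF \<omega>(2) O])
  have \<Delta>_Im: "real_of_int \<Delta> = - 4 * (Im \<omega>)\<^sup>2"
    unfolding \<Delta> by (rule D)
  have \<Delta>_mod: "\<Delta> mod 4 = (if Parity.even t then 0 else 1)"
  proof -
    have "\<Delta> mod 4 = t * t mod 4" unfolding \<Delta> by presburger
    then show ?thesis by (simp only: int_square_mod_4)
  qed
  have square: "(2 * \<omega> - of_int t)\<^sup>2 = of_int \<Delta>"
  proof -
    have "2 * \<omega> - of_int t = 2 * \<i> * of_real (Im \<omega>)"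
      using tN(1) by (simp add: complex_eq_iff)
    then have "(2 * \<omega> - of_int t)\<^sup>2 = of_real (- 4 * (Im \<omega>)\<^sup>2)"
      by (simp add: power_mult_distrib)
    then show ?thesis unfolding \<Delta>_Im[symmetric] by simp
  qed
  \<comment> \<open>The discriminant is the square of \<open>2 * \<omega> - of_int t\<close>, and
    also of \<open>2 * \<tau>\<close> or \<open>2 * \<tau> - 1\<close> according to parity, so these
    agree up to sign.\<close>
  obtain e where "\<tau> = \<omega> + of_int e \<or> \<tau> = - \<omega> + of_int e"
  proof (cases "Parity.even t")
    case True
    then obtain e where e: "t = 2 * e" by blast
    have "(2 * \<tau>)\<^sup>2 = (2 * \<omega> - of_int t)\<^sup>2"
      unfolding square power_mult_distrib using even \<Delta>_mod True by (simp add: mult.commute)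
    then have "2 * \<tau> = 2 * \<omega> - of_int t \<or> 2 * \<tau> = - (2 * \<omega> - of_int t)"
      by (simp only: power2_eq_iff)
    then have "2 * \<tau> = 2 * (\<omega> + of_int (- e)) \<or> 2 * \<tau> = 2 * (- \<omega> + of_int e)"
      by (simp add: e algebra_simps)
    then have "\<tau> = \<omega> + of_int (- e) \<or> \<tau> = - \<omega> + of_int e"
      by (metis mult_left_cancel zero_neq_numeral)
    then show ?thesis using that by metis
  next
    case False
    then obtain e where e: "t = 2 * e + 1" by (rule oddE)
    have "\<tau>\<^sup>2 = \<tau> + (of_int \<Delta> - 1) / 4"
      using odd \<Delta>_mod False by simp
    then have "4 * \<tau>\<^sup>2 = 4 * \<tau> + (of_int \<Delta> - 1)"
      by (simp add: distrib_left)
    then have "(2 * \<tau> - 1)\<^sup>2 = of_int \<Delta>"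
      by (simp add: power2_eq_square algebra_simps)
    then have "(2 * \<tau> - 1)\<^sup>2 = (2 * \<omega> - of_int t)\<^sup>2"
      unfolding square .
    then have "2 * \<tau> - 1 = 2 * \<omega> - of_int t \<or> 2 * \<tau> - 1 = - (2 * \<omega> - of_int t)"
      by (simp only: power2_eq_iff)
    then have "2 * \<tau> = 2 * (\<omega> + of_int (- e)) \<or> 2 * \<tau> = 2 * (- \<omega> + of_int (e + 1))"
      by (auto simp: e algebra_simps)
    then have "\<tau> = \<omega> + of_int (- e) \<or> \<tau> = - \<omega> + of_int (e + 1)"
      by (metis mult_left_cancel zero_neq_numeral)
    then show ?thesis using that by metis
  qed
  then obtain s :: int where s: "s = 1 \<or> s = -1" and \<tau>: "\<tau> = of_int s * \<omega> + of_int e"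
    by (metis of_int_1 of_int_minus mult_1 mult_minus1)
  have \<O>_\<tau>: "\<O> = {of_int m + of_int n * \<tau> |m n. True}"
  proof (intro equalityI subsetI)
    fix x assume "x \<in> \<O>"
    then obtain m n where "x = of_int m + of_int n * \<omega>" unfolding O by blast
    moreover have "\<omega> = of_int s * \<tau> - of_int (s * e)"
      using s \<tau> by auto
    ultimately have "x = of_int (m - n * s * e) + of_int (n * s) * \<tau>"
      by (simp add: algebra_simps)
    then show "x \<in> {of_int m + of_int n * \<tau> |m n. True}" by blast
  next
    fix x assume "x \<in> {of_int m + of_int n * \<tau> |m n. True}"
    then obtain m n where "x = of_int m + of_int n * \<tau>" by blast
    then have "x = of_int (m + n * e) + of_int (n * s) * \<omega>"
      by (simp add: \<tau> algebra_simps)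
    then show "x \<in> \<O>" unfolding O by blast
  qed
  have "\<tau> = of_int 0 + of_int 1 * \<tau>" by simp
  then have "\<tau> \<in> \<O>"
    unfolding \<O>_\<tau> by blast
  then obtain t' N' where "2 * Re \<tau> = of_int t'" "(norm \<tau>)\<^sup>2 = of_int N'"
    by (metis ring_of_integers_iff Ints_cases)
  then have t'N': "\<tau> + cnj \<tau> = of_int t'" "\<tau> * cnj \<tau> = of_int N'"
    using complex_norm_square[of \<tau>] by (simp_all add: complex_add_cnj)
  have "\<not> (Im \<omega>)\<^sup>2 < 3"
    using euclidean_integers_if_Im_small \<omega> assms(4) by blast
  moreover have "(Im \<omega>)\<^sup>2 \<noteq> 3"
    using Im_square_neq_3 \<omega> O by blast
  ultimately have "real_of_int \<Delta> < of_int (- 12)"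
    unfolding \<Delta>_Im by simp
  then have "\<Delta> < - 12"
    by (simp only: of_int_less_iff)
  moreover have "\<Delta> mod 4 = 0 \<or> \<Delta> mod 4 = 1"
    using \<Delta>_mod by simp
  \<comment> \<open>The values - 13 and - 14 are 3 and 2 modulo 4, hence not discriminants.\<close>
  ultimately have "\<Delta> \<le> - 15" by presburger
  then have "real_of_int \<Delta> \<le> - 15" by simp
  moreover have "(Im \<tau>)\<^sup>2 = (Im \<omega>)\<^sup>2"
    using s by (auto simp: \<tau>)
  ultimately have "15 / 4 \<le> (Im \<tau>)\<^sup>2"
    unfolding \<Delta>_Im by simp
  with \<O>_\<tau> t'N' have "imaginary_quadratic_order \<O> \<tau> t' N'"
    by unfold_locales
  then show ?thesis by (rule that)
qed

end

text \<open>Unfolding dimension 2 gives generators u, v of K over the rationals. Cramer's rule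
  replaces them by 1 and a non-real \<alpha>; its determinant is nonzero because a vanishing one
  would force both coefficients of 1 to be zero.\<close>

lemma imag_quadratic_if_imag_quadratic_field:
  assumes "imag_quadratic_field K"
  obtains \<alpha> where "imag_quadratic K \<alpha>"
proof -
  interpret C: field "complex_ring" by (rule field_from_type_algebra)
  have K: "subfield K complex_ring" "C.dimension 2 \<rat> K" "\<not> K \<subseteq> \<real>"
    using assms by (auto simp: imag_quadratic_field_def)
  obtain u E where E: "C.dimension 1 \<rat> E" "K = C.line_extension \<rat> u E"
    using K(2) by (cases rule: C.dimension.cases) auto
  obtain v F where F: "C.dimension 0 \<rat> F" "E = C.line_extension \<rat> v F"
    using E(1) by (cases rule: C.dimension.cases) auto
  have "F = {0}"
    using F(1) by (cases rule: C.dimension.cases) (auto simp: ring_of_type_algebra_def)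
  then have K_eq: "x \<in> K \<longleftrightarrow> (\<exists>a\<in>\<rat>. \<exists>b\<in>\<rat>. x = a * u + b * v)" for x
    unfolding E F Bex_def C.line_extension_mem_iff by (auto simp: ring_of_type_algebra_def)
  have subring: "subring K complex_ring"
    using K(1) by (rule subfieldE)
  obtain \<alpha> where "\<alpha> \<in> K" "\<alpha> \<notin> \<real>"
    using K(3) by blast
  then have \<alpha>: "\<alpha> \<in> K" "Im \<alpha> \<noteq> 0"
    by (simp_all add: complex_is_Real_iff)
  have "\<alpha> * \<alpha> \<in> K" "1 \<in> K"
    using subringE(3,6)[OF subring] \<alpha>(1) by (auto simp: ring_of_type_algebra_def)
  obtain a b where ab: "1 = a * u + b * v" "a \<in> \<rat>" "b \<in> \<rat>"
    using \<open>1 \<in> K\<close> K_eq by blast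
  obtain c d where cd: "\<alpha> = c * u + d * v" "c \<in> \<rat>" "d \<in> \<rat>"
    using \<alpha>(1) K_eq by blast
  define e where "e = a * d - b * c"
  have real: "x \<in> \<rat> \<Longrightarrow> Im x = 0" for x :: complex
    by (auto elim!: Rats_cases')
  have e: "e \<noteq> 0"
  proof
    assume "e = 0"
    have "a * \<alpha> - c * 1 = a * (c * u + d * v) - c * (a * u + b * v)"
      unfolding ab(1)[symmetric] cd(1)[symmetric] ..
    also have "\<dots> = e * v" by (simp add: e_def algebra_simps)
    finally have 1: "a * \<alpha> = c" using \<open>e = 0\<close> by simp
    have "d * 1 - b * \<alpha> = d * (a * u + b * v) - b * (c * u + d * v)"
      unfolding ab(1)[symmetric] cd(1)[symmetric] ..
    also have "\<dots> = e * u" by (simp add: e_def algebra_simps)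
    finally have 2: "b * \<alpha> = d" using \<open>e = 0\<close> by simp
    have "a = 0" "b = 0"
      using arg_cong[OF 1, of Im] arg_cong[OF 2, of Im] real ab cd \<alpha>(2)
      by (auto simp: complex_eq_iff)
    then show False using ab(1) by simp
  qed
  have uv: "u = d / e * 1 + (- b / e) * \<alpha>" "v = - c / e * 1 + a / e * \<alpha>"
  proof -
    have "d * (a * u + b * v) - b * (c * u + d * v) = e * u"
      "a * (c * u + d * v) - c * (a * u + b * v) = e * v"
      by (simp_all add: e_def algebra_simps)
    then have "d * 1 - b * \<alpha> = e * u" "a * \<alpha> - c * 1 = e * v"
      unfolding ab(1)[symmetric] cd(1)[symmetric] .
    moreover have "d / e * 1 + (- b / e) * \<alpha> = (d * 1 - b * \<alpha>) / e"
      "- c / e * 1 + a / e * \<alpha> = (a * \<alpha> - c * 1) / e"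
      by (simp_all add: diff_divide_distrib)
    ultimately show "u = d / e * 1 + (- b / e) * \<alpha>" "v = - c / e * 1 + a / e * \<alpha>"
      using e by simp_all
  qed
  have e_rat: "e \<in> \<rat>" unfolding e_def using ab(2,3) cd(2,3) by auto
  \<comment> \<open>Scalars of the vector space are complex rationals, whereas the presentation of K
    uses real ones; this and the next fact translate between them.\<close>
  have of_real_rat: "\<exists>r. r \<in> \<rat> \<and> x = of_real r" if "x \<in> \<rat>" for x :: complex
  proof -
    obtain k l where "x = of_int k / of_int l" using \<open>x \<in> \<rat>\<close> by (metis Rats_cases')
    then have "x = of_real (of_int k / of_int l)" by simp
    then show ?thesis by (metis Rats_divide Rats_of_int)
  qed
  have rat_of_real: "complex_of_real r \<in> \<rat>" if "r \<in> \<rat>" for r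
  proof -
    obtain k l where "r = of_int k / of_int l" using \<open>r \<in> \<rat>\<close> by (metis Rats_cases')
    then show ?thesis by simp
  qed
  have "K = {of_real r + of_real s * \<alpha> |r s. r \<in> \<rat> \<and> s \<in> \<rat>}"
  proof (intro equalityI subsetI)
    fix x assume "x \<in> K"
    then obtain p q where pq: "x = p * u + q * v" "p \<in> \<rat>" "q \<in> \<rat>"
      using K_eq by blast
    have "x = p * (d / e * 1 + (- b / e) * \<alpha>) + q * (- c / e * 1 + a / e * \<alpha>)"
      unfolding pq(1) uv[symmetric] ..
    then have "x = (p * (d / e) + q * (- c / e)) + (p * (- b / e) + q * (a / e)) * \<alpha>"
      by (simp only: algebra_simps mult_1)
    moreover have "p * (d / e) + q * (- c / e) \<in> \<rat>" "p * (- b / e) + q * (a / e) \<in> \<rat>"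
      using pq(2,3) ab(2,3) cd(2,3) e_rat by auto
    then obtain r s where "r \<in> \<rat>" "p * (d / e) + q * (- c / e) = of_real r"
      "s \<in> \<rat>" "p * (- b / e) + q * (a / e) = of_real s"
      using of_real_rat by meson
    ultimately have "x = of_real r + of_real s * \<alpha>" by simp
    with \<open>r \<in> \<rat>\<close> \<open>s \<in> \<rat>\<close> show "x \<in> {of_real r + of_real s * \<alpha> |r s. r \<in> \<rat> \<and> s \<in> \<rat>}"
      by blast
  next
    fix x assume "x \<in> {of_real r + of_real s * \<alpha> |r s. r \<in> \<rat> \<and> s \<in> \<rat>}"
    then obtain r s where x: "x = of_real r * 1 + of_real s * \<alpha>" and rs: "r \<in> \<rat>" "s \<in> \<rat>" by auto
    have "x = of_real r * (a * u + b * v) + of_real s * (c * u + d * v)"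
      unfolding x ab(1)[symmetric] cd(1)[symmetric] ..
    then have "x = (of_real r * a + of_real s * c) * u + (of_real r * b + of_real s * d) * v"
      by (simp only: algebra_simps)
    moreover have "of_real r * a + of_real s * c \<in> \<rat>" "of_real r * b + of_real s * d \<in> \<rat>"
      using rs rat_of_real ab(2,3) cd(2,3) by auto
    ultimately show "x \<in> K" using K_eq by blast
  qed
  with \<alpha> \<open>\<alpha> * \<alpha> \<in> K\<close> have "imag_quadratic K \<alpha>"
    by unfold_locales
  then show ?thesis by (rule that)
qed

theorem theorem9p5:
  fixes K :: "complex set" and \<Delta> :: int and \<tau> :: complex
  assumes "imag_quadratic_field K"
    and "K \<noteq> generate_field complex_ring {csqrt (- 3)}"
    and "\<Delta> = field_disc K"
    and "\<Delta> mod 4 = 0 \<Longrightarrow> \<tau>\<^sup>2 = of_int \<Delta> / 4"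
    and "\<Delta> mod 4 = 1 \<Longrightarrow> \<tau>\<^sup>2 = \<tau> + (of_int \<Delta> - 1) / 4"
    and "\<not> euclidean_integers K"
  shows "thin_subgroup (orth_group (herm_form \<tau>)) (psl_action \<tau> ` E2 (ring_of_integers K))"
proof -
  obtain \<alpha> where "imag_quadratic K \<alpha>"
    using imag_quadratic_if_imag_quadratic_field[OF assms(1)] .
  then obtain t N where "imaginary_quadratic_order (ring_of_integers K) \<tau> t N"
    using imag_quadratic.imaginary_quadratic_order_integers[OF _ assms(3-6)] by blast
  then show ?thesis
    by (rule imaginary_quadratic_order.thin_E2)
qed

end
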